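(* Consider a state-dependent discrete memoryless channel $W_{Y,Z|X,S}$ with finite alphabets, i.i.d. state distribution $Q_S$, innocent symbol $x_0$, and non-causal channel state information available only at the transmitter (encoder $(M,S^n)\mapsto X^n$, decoder $Y^n\mapsto\hat M$). Let $\mathcal D$ be the set of joint pmfs $$P_{U,V,S,X,Y,Z}=P_UP_VP_{S|U,V}\mathbb 1_{\{X=x(U,S)\}}W_{Y,Z|X,S},$$ where $U,V$ are auxiliary random variables on finite alphabets with $|\mathcal U|\le|\mathcal X|+5$, $|\mathcal V|\le|\mathcal X|+3$, $x:\mathcal U\times\mathcal S\to\mathcal X$ is deterministic, such that $Q_S(s)=\sum_{u,v}P_U(u)P_V(v)P_{S|U,V}(s|u,v)$, $P_Z=Q_0$, and $\mathbb I(V;Y|U)>\max\{\mathbb I(V;Z),\ \mathbb I(U,V;Z)-\mathbb I(U;Y)\}$. Let $$\mathcal S=\{R\ge0:\exists P\in\mathcal D \text{ with } R\le \mathbb I(U;Y)-\max\{\mathbb I(U;S),\ \mathbb I(U,V;S)-\mathbb I(V;Y|U)\}\}.$$ Then the covert capacity satisfies $C_{\mathrm{NC\text{-}T}}\ge\max\{x:x\in\mathcal S\}$.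
   Context: Finite alphabets $\mathcal S,\mathcal X,\mathcal Y,\mathcal Z$. The channel has transition pmf $W_{Y,Z|X,S}$: input $X$, state $S$, output $Y$ at the legitimate receiver and output $Z$ at an adversary (warden). The state sequence $S^n$ is i.i.d. with pmf $Q_S$ and independent of the message; neither the legitimate receiver nor the warden knows the state. $x_0\in\mathcal X$ is a fixed innocent symbol, and $Q_0(z)=\sum_{s}Q_S(s)W_{Z|X,S}(z|x_0,s)$, assumed to have full support on $\mathcal Z$. A $(2^{nR},n)$ code consists of a message $M$ uniform on $\{1,\dots,2^{nR}\}$, an encoder and a decoder of the type specified. $P_{Z^n}$ denotes the distribution of the warden's output induced by the code. A rate $R$ is achievable if there is a sequence of $(2^{nR},n)$ codes with $\mathbb P(\hat M\ne M)\to 0$ and $\mathbb D(P_{Z^n}\|Q_0^{\otimes n})\to 0$ as $n\to\infty$; the covert capacity is the supremum of achievable rates. Mutual informations are computed under the indicated joint pmf. *)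

theory Defs
  imports "HOL-Probability.Probability"
begin

primrec iid_pmf :: "nat \<Rightarrow> 'a pmf \<Rightarrow> 'a list pmf" where
  "iid_pmf 0 p = return_pmf []"
| "iid_pmf (Suc n) p = bind_pmf p (\<lambda>a. map_pmf (\<lambda>xs. a # xs) (iid_pmf n p))"

fun chan_seq :: "('x \<Rightarrow> 's \<Rightarrow> ('y \<times> 'z) pmf) \<Rightarrow> 'x list \<Rightarrow> 's list \<Rightarrow> ('y list \<times> 'z list) pmf" where
  "chan_seq W (x # xs) (s # ss) =
     bind_pmf (W x s) (\<lambda>(y, z). map_pmf (\<lambda>(ys, zs). (y # ys, z # zs)) (chan_seq W xs ss))"
| "chan_seq W _ _ = return_pmf ([], [])"

definition innocent_out :: "'s pmf \<Rightarrow> ('x \<Rightarrow> 's \<Rightarrow> ('y \<times> 'z) pmf) \<Rightarrow> 'x \<Rightarrow> 'z pmf" where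
  "innocent_out QS W x0 = bind_pmf QS (\<lambda>s. map_pmf snd (W x0 s))"

text \<open>Relative entropy (natural log) of pmfs with finite support of the first argument;
  infinite if P is not absolutely continuous w.r.t. Q.\<close>
definition KL_div :: "'a pmf \<Rightarrow> 'a pmf \<Rightarrow> ereal" where
  "KL_div P Q = (if set_pmf P \<subseteq> set_pmf Q
      then ereal (\<Sum>a\<in>set_pmf P. pmf P a * ln (pmf P a / pmf Q a)) else \<infinity>)"

definition num_msgs :: "nat \<Rightarrow> real \<Rightarrow> nat" where
  "num_msgs n R = nat \<lceil>2 powr (real n * R)\<rceil>"

definition nct_code_dist ::
  "nat \<Rightarrow> nat \<Rightarrow> 's pmf \<Rightarrow> ('x \<Rightarrow> 's \<Rightarrow> ('y \<times> 'z) pmf) \<Rightarrow> (nat \<Rightarrow> 's list \<Rightarrow> 'x list)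
   \<Rightarrow> (nat \<times> 'y list \<times> 'z list) pmf" where
  "nct_code_dist n K QS W enc =
     bind_pmf (pmf_of_set {..<K}) (\<lambda>m.
     bind_pmf (iid_pmf n QS) (\<lambda>s.
     map_pmf (\<lambda>(y, z). (m, y, z)) (chan_seq W (enc m s) s)))"

definition nct_error_prob ::
  "nat \<Rightarrow> nat \<Rightarrow> 's pmf \<Rightarrow> ('x \<Rightarrow> 's \<Rightarrow> ('y \<times> 'z) pmf) \<Rightarrow> (nat \<Rightarrow> 's list \<Rightarrow> 'x list)
   \<Rightarrow> ('y list \<Rightarrow> nat) \<Rightarrow> real" where
  "nct_error_prob n K QS W enc dec =
     measure_pmf.prob (nct_code_dist n K QS W enc) {(m, y, z). dec y \<noteq> m}"

definition nct_warden_dist ::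
  "nat \<Rightarrow> nat \<Rightarrow> 's pmf \<Rightarrow> ('x \<Rightarrow> 's \<Rightarrow> ('y \<times> 'z) pmf) \<Rightarrow> (nat \<Rightarrow> 's list \<Rightarrow> 'x list)
   \<Rightarrow> 'z list pmf" where
  "nct_warden_dist n K QS W enc = map_pmf (\<lambda>(m, y, z). z) (nct_code_dist n K QS W enc)"

definition covert_achievable_NCT ::
  "'s pmf \<Rightarrow> ('x \<Rightarrow> 's \<Rightarrow> ('y \<times> 'z) pmf) \<Rightarrow> 'x \<Rightarrow> real \<Rightarrow> bool" where
  "covert_achievable_NCT QS W x0 R \<longleftrightarrow>
     (\<exists>(enc :: nat \<Rightarrow> nat \<Rightarrow> 's list \<Rightarrow> 'x list) (dec :: nat \<Rightarrow> 'y list \<Rightarrow> nat).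
        (\<forall>n m s. length s = n \<longrightarrow> length (enc n m s) = n) \<and>
        (\<lambda>n. nct_error_prob n (num_msgs n R) QS W (enc n) (dec n)) \<longlonglongrightarrow> 0 \<and>
        (\<lambda>n. KL_div (nct_warden_dist n (num_msgs n R) QS W (enc n))
                     (iid_pmf n (innocent_out QS W x0))) \<longlonglongrightarrow> 0)"

definition covert_capacity_NCT ::
  "'s pmf \<Rightarrow> ('x \<Rightarrow> 's \<Rightarrow> ('y \<times> 'z) pmf) \<Rightarrow> 'x \<Rightarrow> ereal" where
  "covert_capacity_NCT QS W x0 = Sup {ereal R | R. covert_achievable_NCT QS W x0 R}"

definition mutual_inf :: "'w pmf \<Rightarrow> ('w \<Rightarrow> 'a) \<Rightarrow> ('w \<Rightarrow> 'b) \<Rightarrow> real" where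
  "mutual_inf p F G =
    (let pab = map_pmf (\<lambda>w. (F w, G w)) p; pa = map_pmf F p; pb = map_pmf G p in
     \<Sum>(a, b)\<in>set_pmf pab. pmf pab (a, b) * log 2 (pmf pab (a, b) / (pmf pa a * pmf pb b)))"

definition cond_mutual_inf ::
  "'w pmf \<Rightarrow> ('w \<Rightarrow> 'a) \<Rightarrow> ('w \<Rightarrow> 'b) \<Rightarrow> ('w \<Rightarrow> 'c) \<Rightarrow> real" where
  "cond_mutual_inf p F G H =
    (let pabc = map_pmf (\<lambda>w. (F w, G w, H w)) p;
         pac = map_pmf (\<lambda>w. (F w, H w)) p; pbc = map_pmf (\<lambda>w. (G w, H w)) p;
         pc = map_pmf H p in
     \<Sum>(a, b, c)\<in>set_pmf pabc.
        pmf pabc (a, b, c) * log 2 (pmf pabc (a, b, c) * pmf pc c / (pmf pac (a, c) * pmf pbc (b, c))))"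

text \<open>Joint pmf P_U P_V P_{S|U,V} 1{X = x(U,S)} W_{Y,Z|X,S} on (U,V,S,X,Y,Z);
  auxiliary alphabets are encoded as initial segments of nat.\<close>
definition nct_joint ::
  "nat pmf \<Rightarrow> nat pmf \<Rightarrow> (nat \<Rightarrow> nat \<Rightarrow> 's pmf) \<Rightarrow> (nat \<Rightarrow> 's \<Rightarrow> 'x)
   \<Rightarrow> ('x \<Rightarrow> 's \<Rightarrow> ('y \<times> 'z) pmf) \<Rightarrow> (nat \<times> nat \<times> 's \<times> 'x \<times> 'y \<times> 'z) pmf" where
  "nct_joint PU PV PS xf W =
     bind_pmf PU (\<lambda>u. bind_pmf PV (\<lambda>v. bind_pmf (PS u v) (\<lambda>s.
       map_pmf (\<lambda>(y, z). (u, v, s, xf u s, y, z)) (W (xf u s) s))))"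

abbreviation "jU \<equiv> (\<lambda>(u, v, s, x, y, z). u)"
abbreviation "jV \<equiv> (\<lambda>(u, v, s, x, y, z). v)"
abbreviation "jS \<equiv> (\<lambda>(u, v, s, x, y, z). s)"
abbreviation "jY \<equiv> (\<lambda>(u, v, s, x, y, z). y)"
abbreviation "jZ \<equiv> (\<lambda>(u, v, s, x, y, z). z)"
abbreviation "jUV \<equiv> (\<lambda>(u, v, s, x, y, z). (u, v))"

definition in_D_NCT ::
  "'s pmf \<Rightarrow> ('x \<Rightarrow> 's \<Rightarrow> ('y \<times> 'z) pmf) \<Rightarrow> 'x
   \<Rightarrow> nat pmf \<Rightarrow> nat pmf \<Rightarrow> (nat \<Rightarrow> nat \<Rightarrow> 's pmf) \<Rightarrow> (nat \<Rightarrow> 's \<Rightarrow> 'x) \<Rightarrow> bool" where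
  "in_D_NCT QS W x0 PU PV PS xf \<longleftrightarrow>
     (let P = nct_joint PU PV PS xf W in
       set_pmf PU \<subseteq> {..<CARD('x) + 5} \<and>
       set_pmf PV \<subseteq> {..<CARD('x) + 3} \<and>
       map_pmf jS P = QS \<and>
       map_pmf jZ P = innocent_out QS W x0 \<and>
       cond_mutual_inf P jV jY jU >
         max (mutual_inf P jV jZ) (mutual_inf P jUV jZ - mutual_inf P jU jY))"

definition rate_set_NCT :: "'s pmf \<Rightarrow> ('x \<Rightarrow> 's \<Rightarrow> ('y \<times> 'z) pmf) \<Rightarrow> 'x \<Rightarrow> real set" where
  "rate_set_NCT QS W x0 = {R. R \<ge> 0 \<and>
     (\<exists>PU PV PS xf. in_D_NCT QS W x0 PU PV PS xf \<and>
        (let P = nct_joint PU PV PS xf W in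
          R \<le> mutual_inf P jU jY
               - max (mutual_inf P jU jS) (mutual_inf P jUV jS - cond_mutual_inf P jV jY jU)))}"

end

theory Submission
  imports Defs
begin

text \<open>
  Put \<open>T = (U, V)\<close>. By the chain rule \<open>I(T;Y) = I(U;Y) + I(V;Y|U)\<close>, so every rate in question is at
  most \<open>I(T;Y) - I(T;S)\<close>, and the condition defining the admissible joint laws gives
  \<open>I(T;Y) > I(T;Z)\<close>. Hence one block of Gelfand--Pinsker coding with the auxiliary variable \<open>T\<close>
  suffices; neither block-Markov coding nor a key extracted from \<open>V\<close> is needed.

  Draw codewords \<open>t(m,l)\<close> i.i.d. with \<open>R + R_l\<close> just below \<open>I(T;Y)\<close> and \<open>R_l\<close> just above \<open>I(T;S)\<close>.
  In the ideal experiment \<open>(m,l)\<close> is uniform and the state is produced from the codeword. Soft covering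
  over \<open>l\<close> makes the ideal law of \<open>(m,s)\<close> close to the true one, soft covering over \<open>(m,l)\<close> makes the
  law of \<open>Z^n\<close> close to \<open>Q_0^n\<close>, and a threshold decoder recovers \<open>m\<close>. The encoder must be a function
  of \<open>(m,s)\<close>, so \<open>l\<close> is sampled once for each pair \<open>(m,s)\<close> from its ideal conditional law, and a third
  use of the same soft covering estimate shows that some sample leaves the law of \<open>Z^n\<close> almost unchanged.
  All errors decay exponentially, which beats the factor \<open>O(n)\<close> lost in passing from total
  variation to relative entropy.
\<close>

section \<open>Soft covering\<close>

abbreviation expct :: "'a pmf \<Rightarrow> ('a \<Rightarrow> real) \<Rightarrow> real" where
  "expct p f \<equiv> measure_pmf.expectation p f"

lemma expct_add:
  "finite (set_pmf p) \<Longrightarrow> expct p (\<lambda>x. f x + g x) = expct p f + expct p g"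
  by (simp add: integrable_measure_pmf_finite)

lemma expct_diff:
  "finite (set_pmf p) \<Longrightarrow> expct p (\<lambda>x. f x - g x) = expct p f - expct p g"
  by (simp add: integrable_measure_pmf_finite)

lemma expct_sum:
  "finite (set_pmf p) \<Longrightarrow> expct p (\<lambda>x. \<Sum>i\<in>I. f i x) = (\<Sum>i\<in>I. expct p (f i))"
  by (rule Bochner_Integration.integral_sum) (simp add: integrable_measure_pmf_finite)

lemma expct_mono:
  assumes "finite (set_pmf p)" "\<And>x. x \<in> set_pmf p \<Longrightarrow> f x \<le> g x"
  shows "expct p f \<le> expct p g"
  using assms by (intro integral_mono_AE) (auto simp: integrable_measure_pmf_finite AE_measure_pmf_iff)

lemma expct_cong:
  "(\<And>x. x \<in> set_pmf p \<Longrightarrow> f x = g x) \<Longrightarrow> expct p f = expct p g"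
  by (intro integral_cong_AE) (auto simp: AE_measure_pmf_iff)

lemma expct_eq_sum:
  assumes "finite A" "set_pmf p \<subseteq> A"
  shows "expct p f = (\<Sum>a\<in>A. pmf p a * f a)"
  using assms by (subst integral_measure_pmf[of A]) auto

lemma expct_bind:
  assumes "finite (set_pmf p)" "\<And>x. x \<in> set_pmf p \<Longrightarrow> finite (set_pmf (f x))"
  shows "expct (bind_pmf p f) h = expct p (\<lambda>x. expct (f x) h)"
  using assms by (subst pmf_expectation_bind[of "set_pmf p"]) (auto simp: expct_eq_sum)

text \<open>The selection principle behind both derandomizations below. The point is found inside
  the support, so a selected codebook keeps the properties of the support.\<close>

lemma ex_le_expct:
  assumes "finite (set_pmf p)" "expct p f \<le> (c::real)"
  shows "\<exists>x\<in>set_pmf p. f x \<le> c"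
proof (rule ccontr)
  assume "\<not> ?thesis"
  hence *: "\<And>x. x \<in> set_pmf p \<Longrightarrow> f x > c" by auto
  have "(\<Sum>x\<in>set_pmf p. pmf p x * c) < (\<Sum>x\<in>set_pmf p. pmf p x * f x)"
    using assms(1) * by (intro sum_strict_mono) (auto simp: set_pmf_not_empty pmf_positive)
  moreover have "(\<Sum>x\<in>set_pmf p. pmf p x * c) = c"
    using assms(1) by (simp add: sum_distrib_right[symmetric] sum_pmf_eq_1)
  ultimately show False using assms by (simp add: expct_eq_sum[of "set_pmf p"])
qed

lemma prob_eq_expct: "measure_pmf.prob p A = expct p (\<lambda>x. of_bool (x \<in> A))"
proof -
  have "expct p (\<lambda>x. of_bool (x \<in> A)) = expct p (indicator A)"
    by (rule expct_cong) (auto simp: indicator_def)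
  thus ?thesis by simp
qed

lemma square_expct_abs_le:
  assumes "finite (set_pmf p)"
  shows "(expct p (\<lambda>x. \<bar>f x\<bar>))\<^sup>2 \<le> expct p (\<lambda>x. (f x)\<^sup>2)"
proof -
  have "0 \<le> measure_pmf.variance p (\<lambda>x. \<bar>f x\<bar>)"
    by (rule measure_pmf.variance_positive)
  also have "\<dots> = expct p (\<lambda>x. \<bar>f x\<bar>\<^sup>2) - (expct p (\<lambda>x. \<bar>f x\<bar>))\<^sup>2"
    using assms by (intro measure_pmf.variance_eq) (auto simp: integrable_measure_pmf_finite)
  finally show ?thesis by simp
qed

section \<open>Independent families: marginals, pairs and second moments\<close>

lemma finite_set_Pi_pmf:
  assumes "finite I" "\<And>i. i \<in> I \<Longrightarrow> finite (set_pmf (p i))"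
  shows "finite (set_pmf (Pi_pmf I d p))"
  using assms by (simp add: set_Pi_pmf finite_PiE_dflt)

lemma expct_Pi_pmf_insert:
  assumes "finite I" "i \<notin> I" "\<And>j. j \<in> insert i I \<Longrightarrow> finite (set_pmf (p j))"
  shows "expct (Pi_pmf (insert i I) d p) h = expct (p i) (\<lambda>x. expct (Pi_pmf I d p) (\<lambda>c. h (c(i := x))))"
proof -
  have fin: "finite (set_pmf (Pi_pmf I d p))"
    using assms by (intro finite_set_Pi_pmf) auto
  show ?thesis
    unfolding Pi_pmf_insert'[OF assms(1,2)]
    by (subst expct_bind) (use assms fin in \<open>auto simp: map_pmf_def[symmetric]\<close>)
qed

lemma expct_Pi_pmf_component:
  assumes "finite I" "i \<in> I"
  shows "expct (Pi_pmf I d p) (\<lambda>c. h (c i)) = expct (p i) h"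
  using integral_map_pmf[of "\<lambda>c. c i" "Pi_pmf I d p" h] Pi_pmf_component[OF assms(1), of i d p] assms(2)
  by simp

lemma expct_Pi_pmf_pair:
  assumes "finite I" "i \<in> I" "j \<in> I" "i \<noteq> j" "\<And>j. j \<in> I \<Longrightarrow> finite (set_pmf (p j))"
  shows "expct (Pi_pmf I d p) (\<lambda>c. F (c i) (c j)) = expct (p i) (\<lambda>x. expct (p j) (F x))"
proof -
  have "expct (Pi_pmf (insert i (I - {i})) d p) (\<lambda>c. F (c i) (c j))
      = expct (p i) (\<lambda>x. expct (Pi_pmf (I - {i}) d p) (\<lambda>c. F x (c j)))"
    using assms by (subst expct_Pi_pmf_insert) auto
  also have "\<dots> = expct (p i) (\<lambda>x. expct (p j) (F x))"
    using assms by (intro expct_cong expct_Pi_pmf_component) auto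
  finally show ?thesis using assms by (simp add: insert_absorb)
qed

text \<open>The variance of a sum of independent terms is the sum of the variances, and each
  variance is at most the second moment. The induction splits off one coordinate at a time.\<close>

lemma expct_Pi_pmf_square_le:
  assumes "finite I" "\<And>i. i \<in> I \<Longrightarrow> finite (set_pmf (p i))"
  shows "expct (Pi_pmf I d p) (\<lambda>c. (\<Sum>i\<in>I. a i (c i) - expct (p i) (a i))\<^sup>2)
      \<le> (\<Sum>i\<in>I. expct (p i) (\<lambda>x. (a i x)\<^sup>2))"
  using assms
proof (induction I rule: finite_induct)
  case empty
  show ?case by simp
next
  case (insert j I)
  let ?m = "\<lambda>i. expct (p i) (a i)"
  define D where "D = (\<lambda>c. \<Sum>i\<in>I. a i (c i) - ?m i)"
  have fin: "finite (set_pmf (Pi_pmf I d p))" and finj: "finite (set_pmf (p j))"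
    using insert by (auto intro: finite_set_Pi_pmf)
  note lin = expct_add[OF fin] expct_add[OF finj] expct_diff[OF finj]
  have Dupd: "D (c(j := x)) = D c" for c x
    unfolding D_def using insert.hyps by (intro sum.cong) auto
  have "expct (Pi_pmf (insert j I) d p) (\<lambda>c. (\<Sum>i\<in>insert j I. a i (c i) - ?m i)\<^sup>2)
      = expct (Pi_pmf (insert j I) d p) (\<lambda>c. (a j (c j) - ?m j + D c)\<^sup>2)"
    unfolding D_def using insert.hyps by simp
  also have "\<dots> = expct (p j) (\<lambda>x. expct (Pi_pmf I d p) (\<lambda>c. (a j x - ?m j + D c)\<^sup>2))"
    using insert by (subst expct_Pi_pmf_insert) (auto simp: Dupd)
  also have "\<dots> = expct (p j) (\<lambda>x. (a j x - ?m j)\<^sup>2 + (a j x - ?m j) * (2 * expct (Pi_pmf I d p) D)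
      + expct (Pi_pmf I d p) (\<lambda>c. (D c)\<^sup>2))"
  proof (rule expct_cong)
    fix x
    have "expct (Pi_pmf I d p) (\<lambda>c. (a j x - ?m j + D c)\<^sup>2)
        = expct (Pi_pmf I d p) (\<lambda>c. (a j x - ?m j)\<^sup>2 + (a j x - ?m j) * 2 * D c + (D c)\<^sup>2)"
      by (intro expct_cong) (simp add: power2_eq_square algebra_simps)
    thus "expct (Pi_pmf I d p) (\<lambda>c. (a j x - ?m j + D c)\<^sup>2)
        = (a j x - ?m j)\<^sup>2 + (a j x - ?m j) * (2 * expct (Pi_pmf I d p) D)
      + expct (Pi_pmf I d p) (\<lambda>c. (D c)\<^sup>2)"
      by (simp add: lin)
  qed
  \<comment> \<open>The cross term vanishes: its factor \<open>a j x - ?m j\<close> has mean zero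
    under \<open>p j\<close>.\<close>
  also have "\<dots> = expct (p j) (\<lambda>x. (a j x - ?m j)\<^sup>2) + expct (Pi_pmf I d p) (\<lambda>c. (D c)\<^sup>2)"
    by (simp add: lin)
  also have "expct (p j) (\<lambda>x. (a j x - ?m j)\<^sup>2) = expct (p j) (\<lambda>x. (a j x)\<^sup>2) - (?m j)\<^sup>2"
    using finj by (intro measure_pmf.variance_eq) (auto simp: integrable_measure_pmf_finite)
  also have "expct (Pi_pmf I d p) (\<lambda>c. (D c)\<^sup>2) \<le> (\<Sum>i\<in>I. expct (p i) (\<lambda>x. (a i x)\<^sup>2))"
    unfolding D_def using insert by auto
  finally show ?case using insert.hyps by (simp add: add_increasing2 algebra_simps)
      (smt (verit) zero_le_power2)
qed

text \<open>The family \<open>c\<close> is a random codebook, and the codeword \<open>c i\<close>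
  adds mass \<open>g i (c i) z\<close> to the output \<open>z\<close>. Each contribution is cut at
  the level \<open>\<theta> * q z\<close>: below it the second moment controls the deviation, above
  it the first moment does. The reference \<open>q\<close> is kept apart from the mean
  \<open>\<mu>\<close>, and the laws may vary with \<open>i\<close>, because the sampling of the
  encoder uses both freedoms.\<close>

theorem soft_covering:
  fixes g :: "'i \<Rightarrow> 'c \<Rightarrow> 'z \<Rightarrow> real"
  assumes I: "finite I" and Z: "finite Z"
    and fin: "\<And>i. i \<in> I \<Longrightarrow> finite (set_pmf (p i))"
    and g0: "\<And>i c z. g i c z \<ge> 0" and q0: "\<And>z. q z \<ge> 0" and q1: "(\<Sum>z\<in>Z. q z) \<le> 1"
    and \<mu>: "\<And>z. \<mu> z = (\<Sum>i\<in>I. expct (p i) (\<lambda>c. g i c z))" and \<mu>1: "(\<Sum>z\<in>Z. \<mu> z) \<le> 1"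
    and \<theta>: "\<theta> \<ge> 0"
  shows "expct (Pi_pmf I d p) (\<lambda>c. \<Sum>z\<in>Z. \<bar>(\<Sum>i\<in>I. g i (c i) z) - \<mu> z\<bar>)
    \<le> 2 * (\<Sum>i\<in>I. expct (p i) (\<lambda>c. \<Sum>z\<in>Z. g i c z * of_bool (g i c z > \<theta> * q z))) + sqrt \<theta>"
proof -
  let ?P = "Pi_pmf I d p"
  have finP: "finite (set_pmf ?P)" using I fin by (rule finite_set_Pi_pmf)
  define a where "a = (\<lambda>z i c. g i c z * of_bool (g i c z \<le> \<theta> * q z))"
  define b where "b = (\<lambda>z i c. g i c z * of_bool (g i c z > \<theta> * q z))"
  have gab: "g i c z = a z i c + b z i c" for i c z
    by (auto simp: a_def b_def)
  have a0: "a z i c \<ge> 0" and b0: "b z i c \<ge> 0" and ag: "a z i c \<le> g i c z" for z i c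
    by (auto simp: a_def b_def g0)
  have Eb0: "0 \<le> expct (p i) (b z i)" for z i
    by (intro Bochner_Integration.integral_nonneg b0)
  have \<mu>0: "\<mu> z \<ge> 0" for z
    unfolding \<mu> by (intro sum_nonneg Bochner_Integration.integral_nonneg g0)
  have \<mu>ab: "\<mu> z = (\<Sum>i\<in>I. expct (p i) (a z i)) + (\<Sum>i\<in>I. expct (p i) (b z i))" for z
    unfolding \<mu> gab by (simp add: sum.distrib[symmetric] expct_add[OF fin])
  have dev: "expct ?P (\<lambda>c. \<bar>(\<Sum>i\<in>I. a z i (c i) - expct (p i) (a z i))\<bar>) \<le> sqrt \<theta> * ((q z + \<mu> z) / 2)"
    (is "?d \<le> _") for z
  proof -
    have "?d\<^sup>2 \<le> expct ?P (\<lambda>c. (\<Sum>i\<in>I. a z i (c i) - expct (p i) (a z i))\<^sup>2)"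
      by (rule square_expct_abs_le[OF finP])
    also have "\<dots> \<le> (\<Sum>i\<in>I. expct (p i) (\<lambda>c. (a z i c)\<^sup>2))"
      using I fin by (rule expct_Pi_pmf_square_le)
    \<comment> \<open>One factor of the square is bounded by the truncation level, the other by
      \<open>g\<close>, which leaves \<open>\<theta> * (q z * \<mu> z)\<close>.\<close>
    also have "\<dots> \<le> (\<Sum>i\<in>I. expct (p i) (\<lambda>c. (\<theta> * q z) * g i c z))"
    proof (intro sum_mono expct_mono fin)
      fix i c
      have "a z i c \<le> \<theta> * q z" using \<theta> q0[of z] by (auto simp: a_def)
      thus "(a z i c)\<^sup>2 \<le> \<theta> * q z * g i c z"
        unfolding power2_eq_square using ag a0 by (intro mult_mono) (auto intro: order_trans[OF a0])
    qed
    also have "\<dots> = \<theta> * (q z * \<mu> z)"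
      by (simp add: \<mu> sum_distrib_left mult.assoc)
    \<comment> \<open>AM-GM replaces the geometric mean of \<open>q z\<close> and
      \<open>\<mu> z\<close> by their average, so the sum over \<open>z\<close> costs no factor of
      the alphabet size.\<close>
    also have "\<dots> \<le> \<theta> * ((q z + \<mu> z) / 2)\<^sup>2"
    proof (rule mult_left_mono[OF _ \<theta>])
      have "0 \<le> (q z - \<mu> z)\<^sup>2" by simp
      thus "q z * \<mu> z \<le> ((q z + \<mu> z) / 2)\<^sup>2" by (simp add: power2_eq_square field_simps)
    qed
    also have "\<dots> = (sqrt \<theta> * ((q z + \<mu> z) / 2))\<^sup>2"
      unfolding power_mult_distrib using \<theta> by simp
    finally show ?thesis
      by (rule power2_le_imp_le) (use \<theta> q0[of z] \<mu>0[of z] in auto)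
  qed
  have "expct ?P (\<lambda>c. \<bar>(\<Sum>i\<in>I. g i (c i) z) - \<mu> z\<bar>)
      \<le> sqrt \<theta> * ((q z + \<mu> z) / 2) + 2 * (\<Sum>i\<in>I. expct (p i) (b z i))" for z
  proof -
    have "expct ?P (\<lambda>c. \<bar>(\<Sum>i\<in>I. g i (c i) z) - \<mu> z\<bar>)
      \<le> expct ?P (\<lambda>c. \<bar>(\<Sum>i\<in>I. a z i (c i) - expct (p i) (a z i))\<bar> + (\<Sum>i\<in>I. b z i (c i))
            + (\<Sum>i\<in>I. expct (p i) (b z i)))"
    proof (rule expct_mono[OF finP])
      fix c
      have "(\<Sum>i\<in>I. g i (c i) z) - \<mu> z
        = (\<Sum>i\<in>I. a z i (c i) - expct (p i) (a z i)) + (\<Sum>i\<in>I. b z i (c i)) - (\<Sum>i\<in>I. expct (p i) (b z i))"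
        unfolding \<mu>ab gab by (simp add: sum.distrib sum_subtractf)
      moreover have "(\<Sum>i\<in>I. b z i (c i)) \<ge> 0" "(\<Sum>i\<in>I. expct (p i) (b z i)) \<ge> 0"
        using b0 Eb0 by (auto intro!: sum_nonneg)
      ultimately show "\<bar>(\<Sum>i\<in>I. g i (c i) z) - \<mu> z\<bar>
        \<le> \<bar>(\<Sum>i\<in>I. a z i (c i) - expct (p i) (a z i))\<bar> + (\<Sum>i\<in>I. b z i (c i)) + (\<Sum>i\<in>I. expct (p i) (b z i))"
        by linarith
    qed
    \<comment> \<open>The overflow \<open>b\<close> is paid twice, once in the sample and once in
      the mean; this is the factor 2 of the bound.\<close>
    also have "\<dots> = expct ?P (\<lambda>c. \<bar>(\<Sum>i\<in>I. a z i (c i) - expct (p i) (a z i))\<bar>)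
        + 2 * (\<Sum>i\<in>I. expct (p i) (b z i))"
      by (simp add: expct_add[OF finP] expct_sum[OF finP] expct_Pi_pmf_component[OF I])
    finally show ?thesis using dev[of z] by linarith
  qed
  hence "(\<Sum>z\<in>Z. expct ?P (\<lambda>c. \<bar>(\<Sum>i\<in>I. g i (c i) z) - \<mu> z\<bar>))
      \<le> (\<Sum>z\<in>Z. sqrt \<theta> * ((q z + \<mu> z) / 2) + 2 * (\<Sum>i\<in>I. expct (p i) (b z i)))"
    by (rule sum_mono)
  also have "\<dots> = sqrt \<theta> * (((\<Sum>z\<in>Z. q z) + (\<Sum>z\<in>Z. \<mu> z)) / 2) + 2 * (\<Sum>z\<in>Z. \<Sum>i\<in>I. expct (p i) (b z i))"
    by (simp add: sum.distrib sum_distrib_left sum_divide_distrib add_divide_distrib algebra_simps)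
  also have "\<dots> \<le> sqrt \<theta> * 1 + 2 * (\<Sum>z\<in>Z. \<Sum>i\<in>I. expct (p i) (b z i))"
    using q1 \<mu>1 \<theta> by (intro add_right_mono mult_left_mono) auto
  also have "(\<Sum>z\<in>Z. \<Sum>i\<in>I. expct (p i) (b z i)) = (\<Sum>i\<in>I. expct (p i) (\<lambda>c. \<Sum>z\<in>Z. b z i c))"
    by (subst sum.swap) (simp add: expct_sum[OF fin])
  finally show ?thesis by (simp add: expct_sum[OF finP] b_def)
qed

section \<open>Pmf computations as finite sums\<close>

lemma pmf_bind_sum:
  assumes "finite A" "set_pmf p \<subseteq> A"
  shows "pmf (bind_pmf p f) x = (\<Sum>a\<in>A. pmf p a * pmf (f a) x)"
  using assms by (simp add: pmf_bind expct_eq_sum)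

lemma prob_bind:
  assumes "finite (set_pmf p)" "\<And>a. a \<in> set_pmf p \<Longrightarrow> finite (set_pmf (f a))"
  shows "measure_pmf.prob (bind_pmf p f) X = expct p (\<lambda>a. measure_pmf.prob (f a) X)"
  unfolding prob_eq_expct by (rule expct_bind[OF assms])

lemma prob_eq_sum:
  assumes "finite A" "set_pmf p \<subseteq> A"
  shows "measure_pmf.prob p X = (\<Sum>a\<in>A. pmf p a * of_bool (a \<in> X))"
  unfolding prob_eq_expct by (rule expct_eq_sum[OF assms])

text \<open>Normalization of the weights \<open>w\<close>, written without division so that zero
  total weight is covered too; a point mass in \<open>A\<close> serves in that case. It supplies the
  ideal conditional law of \<open>l\<close> given \<open>(m, s)\<close>.\<close>

lemma ex_pmf_proportional:
  fixes w :: "'a \<Rightarrow> real"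
  assumes "finite A" "A \<noteq> {}" "\<And>a. a \<in> A \<Longrightarrow> w a \<ge> 0"
  shows "\<exists>g. set_pmf g \<subseteq> A \<and> (\<forall>a\<in>A. (\<Sum>b\<in>A. w b) * pmf g a = w a)"
proof (cases "(\<Sum>b\<in>A. w b) = 0")
  case True
  hence "\<forall>a\<in>A. w a = 0" using assms by (simp add: sum_nonneg_eq_0_iff)
  thus ?thesis using assms(2) True by (intro exI[of _ "return_pmf (SOME a. a \<in> A)"]) (auto simp: some_in_eq)
next
  case False
  define W where "W = (\<Sum>b\<in>A. w b)"
  have W: "W > 0" using False assms(3) sum_nonneg[of A w] unfolding W_def by force
  define f where "f = (\<lambda>a. if a \<in> A then w a / W else 0)"
  have f0: "f a \<ge> 0" for a using W assms(3) by (simp add: f_def)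
  have "(\<integral>\<^sup>+a. ennreal (f a) \<partial>count_space UNIV) = (\<Sum>a\<in>A. ennreal (f a))"
    using assms(1) by (intro nn_integral_count_space') (auto simp: f_def)
  also have "\<dots> = ennreal (\<Sum>a\<in>A. f a)" using f0 by (simp add: sum_ennreal)
  also have "(\<Sum>a\<in>A. f a) = 1"
    using W by (simp add: f_def sum_divide_distrib[symmetric] W_def[symmetric])
  finally have "(\<integral>\<^sup>+a. ennreal (f a) \<partial>count_space UNIV) = 1" by simp
  hence pmf: "pmf (embed_pmf f) a = f a" for a using f0 by (intro pmf_embed_pmf) auto
  show ?thesis
    using W by (intro exI[of _ "embed_pmf f"], unfold set_pmf_eq pmf W_def[symmetric]) (auto simp: f_def)
qed

lemma sum_of_bool_eq_mult:
  fixes h :: "'a \<Rightarrow> real"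
  assumes "finite A" "i \<in> A"
  shows "(\<Sum>m\<in>A. of_bool (i = m) * h m) = h i" "(\<Sum>m\<in>A. of_bool (m = i) * h m) = h i"
proof -
  have "(\<Sum>m\<in>A. of_bool (i = m) * h m) = (\<Sum>m\<in>A. if i = m then h m else 0)"
    by (intro sum.cong) auto
  also have "\<dots> = h i" using assms by simp
  finally show "(\<Sum>m\<in>A. of_bool (i = m) * h m) = h i" .
  thus "(\<Sum>m\<in>A. of_bool (m = i) * h m) = h i" by (simp add: eq_commute)
qed

section \<open>One-shot coding with state information at the encoder\<close>

text \<open>
  A codeword \<open>t\<close> has law \<open>p\<close>; \<open>k t\<close> is the reverse kernel that produces the state from the codeword
  (so \<open>bind_pmf p k\<close> is the law of the true state), and \<open>wy t s\<close>, \<open>wz t s\<close> are the output laws with the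
  input symbol already substituted as a function of \<open>t\<close> and \<open>s\<close>.
\<close>

locale state_code =
  fixes p :: "'t pmf" and k :: "'t \<Rightarrow> 's pmf"
    and wy :: "'t \<Rightarrow> 's \<Rightarrow> 'y pmf" and wz :: "'t \<Rightarrow> 's \<Rightarrow> 'z pmf"
    and S :: "'s set" and Z :: "'z set" and K L :: nat
  assumes fin_p: "finite (set_pmf p)" and fin_S: "finite S" and fin_Z: "finite Z"
    and fin_y: "\<And>t s. finite (set_pmf (wy t s))"
    and k_S: "\<And>t. t \<in> set_pmf p \<Longrightarrow> set_pmf (k t) \<subseteq> S"
    and wz_Z: "\<And>t s. t \<in> set_pmf p \<Longrightarrow> s \<in> S \<Longrightarrow> set_pmf (wz t s) \<subseteq> Z"
    and K: "K > 0" and L: "L > 0"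
begin

definition "PS = bind_pmf p k"
definition "ky t = bind_pmf (k t) (wy t)"
definition "kz t = bind_pmf (k t) (wz t)"
definition "PY = bind_pmf p ky"
definition "PZ = bind_pmf p kz"

text \<open>\<open>cover_S\<close>, \<open>cover_Z\<close> and \<open>pack_Y\<close> are tails of
  information densities: the density of \<open>s\<close> exceeding
  \<open>log (L * \<alpha>)\<close>, that of \<open>z\<close> exceeding
  \<open>log (K * L * \<beta>)\<close>, and that of \<open>y\<close> not exceeding
  \<open>log \<gamma>\<close>.\<close>

definition "cover_S \<alpha> = expct p (\<lambda>t. measure_pmf.prob (k t) {s. pmf (k t) s > real L * \<alpha> * pmf PS s})"
definition "cover_Z \<beta> = expct p (\<lambda>t. measure_pmf.prob (kz t) {z. pmf (kz t) z > real K * real L * \<beta> * pmf PZ z})"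
definition "pack_Y \<gamma> = expct p (\<lambda>t. measure_pmf.prob (ky t) {y. pmf (ky t) y \<le> \<gamma> * pmf PY y})"
text \<open>Overflow event of the third covering: one draw of \<open>l\<close> for the pair
  \<open>(m, s)\<close> puts mass \<open>pmf PS s / real K * pmf (wz t s) z\<close> on
  \<open>z\<close>, to be compared with \<open>\<theta> * pmf PZ z\<close>.\<close>

definition "atyp \<theta> t s = measure_pmf.prob (wz t s) {z. pmf PS s * pmf (wz t s) z > real K * \<theta> * pmf PZ z}"
definition "cover_SZ \<theta> = expct p (\<lambda>t. expct (k t) (atyp \<theta> t))"

definition "I = {..<K} \<times> {..<L}"
definition "J = {..<K} \<times> S"

text \<open>The default lies in the support of \<open>p\<close>, so \<open>c i\<close> is a
  legitimate codeword also outside \<open>I\<close>. For block codes this gives the encoder the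
  right length at every \<open>m\<close> and \<open>s\<close>.\<close>

definition "codebook = Pi_pmf I (SOME t. t \<in> set_pmf p) (\<lambda>_. p)"

text \<open>\<open>dev_S\<close> and \<open>dev_Z\<close> are L1 distances between the ideal and the
  target laws of \<open>(m, s)\<close> and of \<open>z\<close>, while \<open>err\<close> and
  \<open>dev_SZ\<close> are averages in the ideal experiment.\<close>

definition "dev_S c = (\<Sum>(m,s)\<in>J. \<bar>(\<Sum>l<L. pmf (k (c (m,l))) s / (real K * real L)) - pmf PS s / real K\<bar>)"
definition "dev_Z c = (\<Sum>z\<in>Z. \<bar>(\<Sum>i\<in>I. pmf (kz (c i)) z / (real K * real L)) - pmf PZ z\<bar>)"
definition "err c dec = (\<Sum>i\<in>I. measure_pmf.prob (ky (c i)) {y. dec y \<noteq> fst i} / (real K * real L))"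
definition "dev_SZ \<theta> c = (\<Sum>i\<in>I. expct (k (c i)) (atyp \<theta> (c i)) / (real K * real L))"
text \<open>If no message qualifies or several do, the choice is arbitrary; \<open>expct_err\<close>
  charges both cases to error events.\<close>

definition "dec \<gamma> c y = (SOME m. m < K \<and> (\<exists>l<L. pmf (ky (c (m,l))) y > \<gamma> * pmf PY y))"

lemma fin_I: "finite I" and fin_J: "finite J" and card_I: "card I = K * L"
  using fin_S by (auto simp: I_def J_def)

lemma KL: "real K > 0" "real L > 0" using K L by auto

lemma fin_codebook: "finite (set_pmf codebook)"
  unfolding codebook_def using fin_I fin_p by (intro finite_set_Pi_pmf)

lemma codebook_in_p: "c \<in> set_pmf codebook \<Longrightarrow> c i \<in> set_pmf p"
proof -
  have "(SOME t. t \<in> set_pmf p) \<in> set_pmf p" by (simp add: some_in_eq set_pmf_not_empty)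
  moreover assume "c \<in> set_pmf codebook"
  ultimately show ?thesis
    unfolding codebook_def set_Pi_pmf[OF fin_I] PiE_dflt_def by (cases "i \<in> I") (simp_all del: split_paired_All)
qed

lemma fin_k: "t \<in> set_pmf p \<Longrightarrow> finite (set_pmf (k t))"
  using k_S fin_S finite_subset by blast

lemma fin_ky: "t \<in> set_pmf p \<Longrightarrow> finite (set_pmf (ky t))"
  using fin_k fin_y by (simp add: ky_def)

lemma kz_Z: "t \<in> set_pmf p \<Longrightarrow> set_pmf (kz t) \<subseteq> Z"
  using k_S wz_Z by (fastforce simp: kz_def)

lemma PS_S: "set_pmf PS \<subseteq> S" using k_S by (auto simp: PS_def)
lemma PZ_Z: "set_pmf PZ \<subseteq> Z" using kz_Z by (auto simp: PZ_def)

lemma sum_PZ: "(\<Sum>z\<in>Z. pmf PZ z) = 1"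
  using fin_Z PZ_Z by (rule sum_pmf_eq_1)

lemma sum_PS: "(\<Sum>s\<in>S. pmf PS s) = 1"
  using fin_S PS_S by (rule sum_pmf_eq_1)

lemma sum_J: "(\<Sum>(m,s)\<in>J. h m s) = (\<Sum>m<K. \<Sum>s\<in>S. h m s)"
  by (simp add: J_def sum.cartesian_product)

lemma sum_I: "(\<Sum>i\<in>I. h (fst i) (snd i)) = (\<Sum>m<K. \<Sum>l<L. h m l)"
  by (simp add: I_def sum.cartesian_product case_prod_beta)

lemma sum_I_const: "(\<Sum>i\<in>I. x / (real K * real L)) = (x::real)"
  using KL by (simp add: card_I)

section \<open>Averages over the random codebook\<close>

lemma expct_dev_S:
  assumes "\<alpha> \<ge> 0"
  shows "expct codebook dev_S \<le> 2 * cover_S \<alpha> + sqrt \<alpha>"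
proof -
  \<comment> \<open>One application of soft covering with output \<open>(m, s)\<close> handles the subcodebooks of all messages.\<close>
  define g where "g = (\<lambda>(i::nat \<times> nat) t (m, s). of_bool (fst i = m) * (pmf (k t) s / (real K * real L)))"
  define q where "q = (\<lambda>(m::nat, s). pmf PS s / real K)"
  have mu: "q x = (\<Sum>i\<in>I. expct p (\<lambda>t. g i t x))" if "x \<in> J" for x
  proof -
    obtain m s where x: "x = (m, s)" "m < K" using \<open>x \<in> J\<close> by (auto simp: J_def)
    have "(\<Sum>i\<in>I. expct p (\<lambda>t. g i t x))
        = (\<Sum>i\<in>I. of_bool (fst i = m) * (pmf PS s / (real K * real L)))"
      by (simp add: g_def x PS_def pmf_bind)
    also have "\<dots> = (\<Sum>m'<K. \<Sum>l<L. of_bool (m' = m) * (pmf PS s / (real K * real L)))"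
      by (rule sum_I)
    also have "\<dots> = pmf PS s / real K"
      using x KL by (simp add: of_bool_def sum.delta if_distrib if_distribR cong: if_cong)
    finally show ?thesis by (simp add: q_def x)
  qed
  have q1: "(\<Sum>x\<in>J. q x) = 1"
    using KL by (simp add: q_def sum_J sum_divide_distrib[symmetric] sum_PS)
  \<comment> \<open>\<open>soft_covering\<close> wants the mean at every point, whereas
    \<open>q\<close> agrees with it on \<open>J\<close>: no codeword gives mass to a message index
    beyond \<open>K\<close>.\<close>
  define \<mu> where "\<mu> = (\<lambda>x. \<Sum>i\<in>I. expct p (\<lambda>t. g i t x))"
  have "expct (Pi_pmf I (SOME t. t \<in> set_pmf p) (\<lambda>_. p)) (\<lambda>c. \<Sum>x\<in>J. \<bar>(\<Sum>i\<in>I. g i (c i) x) - \<mu> x\<bar>)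
    \<le> 2 * (\<Sum>i\<in>I. expct p (\<lambda>t. \<Sum>x\<in>J. g i t x * of_bool (g i t x > \<alpha> * q x))) + sqrt \<alpha>"
  proof (rule soft_covering[OF fin_I fin_J])
    show "(\<Sum>x\<in>J. \<mu> x) \<le> 1" using q1 mu by (simp add: \<mu>_def)
  qed (use fin_p q1 assms in \<open>auto simp: g_def q_def \<mu>_def\<close>)
  also have "(\<Sum>i\<in>I. expct p (\<lambda>t. \<Sum>x\<in>J. g i t x * of_bool (g i t x > \<alpha> * q x)))
      = (\<Sum>i\<in>I. cover_S \<alpha> / (real K * real L))"
  proof (rule sum.cong[OF refl])
    fix i assume "i \<in> I"
    hence i: "fst i < K" by (auto simp: I_def)
    have "expct p (\<lambda>t. \<Sum>x\<in>J. g i t x * of_bool (g i t x > \<alpha> * q x))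
       = expct p (\<lambda>t. measure_pmf.prob (k t) {s. pmf (k t) s > real L * \<alpha> * pmf PS s} / (real K * real L))"
    proof (rule expct_cong)
      fix t assume t: "t \<in> set_pmf p"
      have "(\<Sum>x\<in>J. g i t x * of_bool (g i t x > \<alpha> * q x))
        = (\<Sum>(m,s)\<in>J. of_bool (fst i = m) * (pmf (k t) s / (real K * real L)
              * of_bool (pmf (k t) s / (real K * real L) > \<alpha> * (pmf PS s / real K))))"
        by (intro sum.cong) (auto simp: g_def q_def)
      also have "\<dots> = (\<Sum>m<K. \<Sum>s\<in>S. of_bool (fst i = m) * (pmf (k t) s / (real K * real L)
              * of_bool (pmf (k t) s / (real K * real L) > \<alpha> * (pmf PS s / real K))))"
        by (rule sum_J)
      also have "\<dots> = (\<Sum>m<K. of_bool (fst i = m) * (\<Sum>s\<in>S. pmf (k t) s / (real K * real L)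
              * of_bool (pmf (k t) s / (real K * real L) > \<alpha> * (pmf PS s / real K))))"
        by (simp only: sum_distrib_left)
      also have "\<dots> = (\<Sum>s\<in>S. pmf (k t) s / (real K * real L)
              * of_bool (pmf (k t) s / (real K * real L) > \<alpha> * (pmf PS s / real K)))"
        using i by (intro sum_of_bool_eq_mult) auto
      \<comment> \<open>\<open>K\<close> cancels from the threshold: the state is covered by the
        \<open>L\<close> codewords of a single message.\<close>
      also have "\<dots> = (\<Sum>s\<in>S. (pmf (k t) s * of_bool (pmf (k t) s > real L * \<alpha> * pmf PS s)) / (real K * real L))"
        using KL by (intro sum.cong refl) (simp add: field_simps)
      also have "\<dots> = measure_pmf.prob (k t) {s. pmf (k t) s > real L * \<alpha> * pmf PS s} / (real K * real L)"
        by (subst prob_eq_sum[OF fin_S k_S[OF t]]) (simp add: sum_divide_distrib)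
      finally show "(\<Sum>x\<in>J. g i t x * of_bool (g i t x > \<alpha> * q x)) = \<dots>" .
    qed
    thus "expct p (\<lambda>t. \<Sum>x\<in>J. g i t x * of_bool (g i t x > \<alpha> * q x)) = cover_S \<alpha> / (real K * real L)"
      by (simp add: cover_S_def)
  qed
  also have "\<dots> = cover_S \<alpha>" by (rule sum_I_const)
  also have "(\<lambda>c. \<Sum>x\<in>J. \<bar>(\<Sum>i\<in>I. g i (c i) x) - \<mu> x\<bar>) = dev_S"
  proof
    fix c
    have "(\<Sum>i\<in>I. g i (c i) (m, s)) = (\<Sum>l<L. pmf (k (c (m,l))) s / (real K * real L))" if "m < K" for m s
    proof -
      have "(\<Sum>i\<in>I. g i (c i) (m, s))
          = (\<Sum>i\<in>I. (\<lambda>m' l. of_bool (m' = m) * (pmf (k (c (m',l))) s / (real K * real L))) (fst i) (snd i))"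
        by (simp add: g_def)
      also have "\<dots> = (\<Sum>m'<K. \<Sum>l<L. of_bool (m' = m) * (pmf (k (c (m',l))) s / (real K * real L)))"
        by (rule sum_I)
      also have "\<dots> = (\<Sum>m'<K. of_bool (m' = m) * (\<Sum>l<L. pmf (k (c (m',l))) s / (real K * real L)))"
        by (simp only: sum_distrib_left)
      also have "\<dots> = (\<Sum>l<L. pmf (k (c (m,l))) s / (real K * real L))"
        using that by (intro sum_of_bool_eq_mult) auto
      finally show ?thesis .
    qed
    thus "(\<Sum>x\<in>J. \<bar>(\<Sum>i\<in>I. g i (c i) x) - \<mu> x\<bar>) = dev_S c"
      unfolding dev_S_def by (intro sum.cong refl) (auto simp: \<mu>_def mu[symmetric] q_def J_def)
  qed
  finally show ?thesis by (simp add: codebook_def)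
qed

text \<open>All \<open>K * L\<close> codewords cover the warden's output together, hence the
  threshold \<open>real K * real L * \<beta>\<close> in \<open>cover_Z\<close>.\<close>

lemma expct_dev_Z:
  assumes "\<beta> \<ge> 0"
  shows "expct codebook dev_Z \<le> 2 * cover_Z \<beta> + sqrt \<beta>"
proof -
  let ?g = "\<lambda>i t z. pmf (kz t) z / (real K * real L)"
  have mu: "(\<Sum>i\<in>I. expct p (\<lambda>t. ?g i t z)) = pmf PZ z" for z
    using sum_I_const[of "pmf PZ z"] by (simp add: PZ_def pmf_bind)
  have "expct (Pi_pmf I (SOME t. t \<in> set_pmf p) (\<lambda>_. p)) (\<lambda>c. \<Sum>z\<in>Z. \<bar>(\<Sum>i\<in>I. ?g i (c i) z) - pmf PZ z\<bar>)
    \<le> 2 * (\<Sum>i\<in>I. expct p (\<lambda>t. \<Sum>z\<in>Z. ?g i t z * of_bool (?g i t z > \<beta> * pmf PZ z))) + sqrt \<beta>"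
    by (rule soft_covering[OF fin_I fin_Z]) (use fin_p sum_PZ assms mu in auto)
  also have "(\<Sum>i\<in>I. expct p (\<lambda>t. \<Sum>z\<in>Z. ?g i t z * of_bool (?g i t z > \<beta> * pmf PZ z)))
      = (\<Sum>i\<in>I. cover_Z \<beta> / (real K * real L))"
  proof (rule sum.cong[OF refl])
    fix i
    have "expct p (\<lambda>t. \<Sum>z\<in>Z. ?g i t z * of_bool (?g i t z > \<beta> * pmf PZ z))
       = expct p (\<lambda>t. measure_pmf.prob (kz t) {z. pmf (kz t) z > real K * real L * \<beta> * pmf PZ z} / (real K * real L))"
    proof (rule expct_cong)
      fix t assume t: "t \<in> set_pmf p"
      have "(\<Sum>z\<in>Z. ?g i t z * of_bool (?g i t z > \<beta> * pmf PZ z))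
        = (\<Sum>z\<in>Z. (pmf (kz t) z * of_bool (pmf (kz t) z > real K * real L * \<beta> * pmf PZ z)) / (real K * real L))"
        using KL by (intro sum.cong refl) (simp add: field_simps)
      thus "(\<Sum>z\<in>Z. ?g i t z * of_bool (?g i t z > \<beta> * pmf PZ z))
        = measure_pmf.prob (kz t) {z. pmf (kz t) z > real K * real L * \<beta> * pmf PZ z} / (real K * real L)"
        by (subst prob_eq_sum[OF fin_Z kz_Z[OF t]]) (simp add: sum_divide_distrib)
    qed
    thus "expct p (\<lambda>t. \<Sum>z\<in>Z. ?g i t z * of_bool (?g i t z > \<beta> * pmf PZ z)) = cover_Z \<beta> / (real K * real L)"
      by (simp add: cover_Z_def)
  qed
  also have "\<dots> = cover_Z \<beta>" by (rule sum_I_const)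
  finally show ?thesis by (simp add: codebook_def dev_Z_def[abs_def])
qed

lemma expct_dev_SZ: "expct codebook (dev_SZ \<theta>) = cover_SZ \<theta>"
  unfolding dev_SZ_def expct_sum[OF fin_codebook]
  using expct_Pi_pmf_component[OF fin_I, of _ "SOME t. t \<in> set_pmf p" "\<lambda>_. p" "\<lambda>t. expct (k t) (atyp \<theta> t)"]
    sum_I_const[of "cover_SZ \<theta>"]
  by (simp add: codebook_def cover_SZ_def)

text \<open>The codewords \<open>c i\<close> and \<open>c j\<close> are independent, so averaging
  over \<open>c i\<close> turns its output law into \<open>PY\<close>. Where \<open>c j\<close>
  passes the threshold, the mass of \<open>PY\<close> is below that of \<open>ky (c j)\<close>
  divided by \<open>\<gamma>\<close>, and these quotients sum to at most
  \<open>1 / \<gamma>\<close>.\<close>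

lemma expct_false_alarm:
  assumes "\<gamma> > 0" "i \<in> I" "j \<in> I" "i \<noteq> j"
  shows "expct codebook (\<lambda>c. measure_pmf.prob (ky (c i)) {y. pmf (ky (c j)) y > \<gamma> * pmf PY y}) \<le> 1 / \<gamma>"
proof -
  have finPY: "finite (set_pmf PY)" using fin_p fin_ky by (auto simp: PY_def)
  let ?F = "\<lambda>t' t. measure_pmf.prob (ky t) {y. pmf (ky t') y > \<gamma> * pmf PY y}"
  have "expct codebook (\<lambda>c. ?F (c j) (c i)) = expct p (\<lambda>t'. expct p (?F t'))"
    unfolding codebook_def using assms fin_I fin_p by (intro expct_Pi_pmf_pair) auto
  also have "\<dots> \<le> expct p (\<lambda>t'. 1 / \<gamma>)"
  proof (rule expct_mono[OF fin_p])
    fix t' assume t': "t' \<in> set_pmf p"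
    have "expct p (?F t') = measure_pmf.prob PY {y. pmf (ky t') y > \<gamma> * pmf PY y}"
      unfolding PY_def using fin_p fin_ky by (subst prob_bind) auto
    also have "\<dots> = (\<Sum>y\<in>set_pmf PY. pmf PY y * of_bool (pmf (ky t') y > \<gamma> * pmf PY y))"
      by (subst prob_eq_sum[OF finPY]) auto
    also have "\<dots> \<le> (\<Sum>y\<in>set_pmf PY. pmf (ky t') y / \<gamma>)"
      using assms(1) by (intro sum_mono) (auto simp: field_simps)
    also have "\<dots> \<le> 1 / \<gamma>"
      unfolding sum_divide_distrib[symmetric] measure_measure_pmf_finite[OF finPY, symmetric]
      using assms(1) by (intro divide_right_mono) auto
    finally show "expct p (?F t') \<le> 1 / \<gamma>" .
  qed
  finally show ?thesis by simp
qed

lemma expct_err: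
  assumes "\<gamma> > 0"
  shows "expct codebook (\<lambda>c. err c (dec \<gamma> c)) \<le> pack_Y \<gamma> + real K * real L / \<gamma>"
proof -
  let ?A = "\<lambda>t. {y. pmf (ky t) y \<le> \<gamma> * pmf PY y}"
  let ?B = "\<lambda>t. {y. pmf (ky t) y > \<gamma> * pmf PY y}"
  \<comment> \<open>Decoding fails only if the sent codeword misses the threshold or another one
    passes it. Other codewords of the same message are included, which merely enlarges the
    union.\<close>
  have sub: "{y. dec \<gamma> c y \<noteq> fst i} \<subseteq> ?A (c i) \<union> (\<Union>j\<in>I - {i}. ?B (c j))" if "i \<in> I" for c i
  proof (rule subsetI, rule ccontr)
    fix y assume y: "y \<in> {y. dec \<gamma> c y \<noteq> fst i}"
      and n: "y \<notin> ?A (c i) \<union> (\<Union>j\<in>I - {i}. ?B (c j))"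
    have "fst i < K \<and> (\<exists>l<L. pmf (ky (c (fst i,l))) y > \<gamma> * pmf PY y)"
      using n that by (intro conjI exI[of _ "snd i"]) (auto simp: I_def)
    hence "dec \<gamma> c y < K \<and> (\<exists>l<L. pmf (ky (c (dec \<gamma> c y, l))) y > \<gamma> * pmf PY y)"
      unfolding dec_def by (rule someI)
    then obtain l where "(dec \<gamma> c y, l) \<in> I" "pmf (ky (c (dec \<gamma> c y, l))) y > \<gamma> * pmf PY y"
      by (auto simp: I_def)
    with n y show False by fastforce
  qed
  have one: "expct codebook (\<lambda>c. measure_pmf.prob (ky (c i)) {y. dec \<gamma> c y \<noteq> fst i})
      \<le> pack_Y \<gamma> + real K * real L / \<gamma>" if i: "i \<in> I" for i
  proof -
    have "expct codebook (\<lambda>c. measure_pmf.prob (ky (c i)) {y. dec \<gamma> c y \<noteq> fst i})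
      \<le> expct codebook (\<lambda>c. measure_pmf.prob (ky (c i)) (?A (c i))
            + (\<Sum>j\<in>I - {i}. measure_pmf.prob (ky (c i)) (?B (c j))))"
    proof (rule expct_mono[OF fin_codebook])
      fix c
      have "measure_pmf.prob (ky (c i)) {y. dec \<gamma> c y \<noteq> fst i}
          \<le> measure_pmf.prob (ky (c i)) (?A (c i) \<union> (\<Union>j\<in>I - {i}. ?B (c j)))"
        using sub[OF i] by (intro measure_pmf.finite_measure_mono) auto
      also have "\<dots> \<le> measure_pmf.prob (ky (c i)) (?A (c i))
          + measure_pmf.prob (ky (c i)) (\<Union>j\<in>I - {i}. ?B (c j))"
        by (rule measure_Un_le) auto
      also have "measure_pmf.prob (ky (c i)) (\<Union>j\<in>I - {i}. ?B (c j))
          \<le> (\<Sum>j\<in>I - {i}. measure_pmf.prob (ky (c i)) (?B (c j)))"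
        using fin_I by (intro measure_UNION_le) auto
      finally show "measure_pmf.prob (ky (c i)) {y. dec \<gamma> c y \<noteq> fst i}
          \<le> measure_pmf.prob (ky (c i)) (?A (c i)) + (\<Sum>j\<in>I - {i}. measure_pmf.prob (ky (c i)) (?B (c j)))"
        by simp
    qed
    also have "\<dots> = pack_Y \<gamma> + (\<Sum>j\<in>I - {i}. expct codebook (\<lambda>c. measure_pmf.prob (ky (c i)) (?B (c j))))"
      unfolding expct_add[OF fin_codebook] expct_sum[OF fin_codebook]
      unfolding codebook_def pack_Y_def
      by (subst expct_Pi_pmf_component[OF fin_I i, of _ _ "\<lambda>t. measure_pmf.prob (ky t) (?A t)"]) simp
    also have "(\<Sum>j\<in>I - {i}. expct codebook (\<lambda>c. measure_pmf.prob (ky (c i)) (?B (c j)))) \<le> (\<Sum>j\<in>I - {i}. 1 / \<gamma>)"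
      using i assms by (intro sum_mono expct_false_alarm) auto
    also have "\<dots> \<le> (\<Sum>j\<in>I. 1 / \<gamma>)"
      using fin_I assms by (intro sum_mono2) auto
    also have "\<dots> = real K * real L / \<gamma>" by (simp add: card_I)
    finally show ?thesis by simp
  qed
  have "expct codebook (\<lambda>c. err c (dec \<gamma> c))
    = (\<Sum>i\<in>I. expct codebook (\<lambda>c. measure_pmf.prob (ky (c i)) {y. dec \<gamma> c y \<noteq> fst i}) / (real K * real L))"
    unfolding err_def by (simp add: expct_sum[OF fin_codebook])
  also have "\<dots> \<le> (\<Sum>i\<in>I. (pack_Y \<gamma> + real K * real L / \<gamma>) / (real K * real L))"
    using one KL by (intro sum_mono divide_right_mono) auto
  also have "\<dots> = pack_Y \<gamma> + real K * real L / \<gamma>" by (rule sum_I_const)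
  finally show ?thesis .
qed

end

section \<open>From sampled to deterministic encoders\<close>

context state_code
begin

lemma expct_k_sum:
  assumes "t \<in> set_pmf p"
  shows "expct (k t) h = (\<Sum>s\<in>S. pmf (k t) s * h s)"
  using assms by (intro expct_eq_sum fin_S k_S)

text \<open>The index \<open>l\<close> is drawn independently for each pair \<open>(m, s)\<close>,
  and averaging over these draws yields one fixed choice. The error is a sum of terms depending on
  one draw each, so its mean suffices; the law of \<open>z\<close> enters through absolute values
  and needs \<open>soft_covering\<close> over the index set \<open>J\<close>.\<close>

lemma ex_encoder:
  assumes c: "c \<in> set_pmf codebook" and \<theta>: "\<theta> \<ge> 0"
  shows "\<exists>f. (\<forall>m s. f m s \<in> set_pmf p) \<and>
     (\<Sum>(m,s)\<in>J. pmf PS s / real K * measure_pmf.prob (wy (f m s) s) {y. dc y \<noteq> m})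
     + (\<Sum>z\<in>Z. \<bar>(\<Sum>(m,s)\<in>J. pmf PS s / real K * pmf (wz (f m s) s) z) - pmf PZ z\<bar>)
     \<le> 4 * dev_S c + dev_Z c + err c dc + 2 * dev_SZ \<theta> c + sqrt \<theta>"
proof -
  note cp = codebook_in_p[OF c]
  have "\<exists>g. set_pmf g \<subseteq> {..<L} \<and> (\<forall>l\<in>{..<L}. (\<Sum>l<L. pmf (k (c (m,l))) s) * pmf g l = pmf (k (c (m,l))) s)" for m s
    using L by (intro ex_pmf_proportional) (auto simp: lessThan_empty_iff)
  then obtain g where gL: "\<And>m s. set_pmf (g m s) \<subseteq> {..<L}"
    and gk: "\<And>m s l. l < L \<Longrightarrow> (\<Sum>l<L. pmf (k (c (m,l))) s) * pmf (g m s) l = pmf (k (c (m,l))) s"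
    by (metis lessThan_iff)
  have fin_g: "finite (set_pmf (g m s))" for m s using gL finite_subset by blast
  \<comment> \<open>\<open>act\<close> and \<open>idl\<close> integrate over \<open>(m,s,l)\<close> under the true law with likelihood encoder \<open>g\<close> and under
    the ideal law; both have the same conditional law of \<open>l\<close>, so they differ by at most \<open>dev_S c\<close>.\<close>
  define act where "act = (\<lambda>h. \<Sum>(m,s)\<in>J. \<Sum>l<L. pmf PS s / real K * pmf (g m s) l * (h m s l :: real))"
  define idl where "idl = (\<lambda>h. \<Sum>(m,s)\<in>J. \<Sum>l<L. pmf (k (c (m,l))) s / (real K * real L) * (h m s l :: real))"
  define a where "a = (\<lambda>m s. \<bar>(\<Sum>l<L. pmf (k (c (m,l))) s / (real K * real L)) - pmf PS s / real K\<bar>)"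
  have dev: "dev_S c = (\<Sum>(m,s)\<in>J. a m s)" by (simp add: dev_S_def a_def)
  have diff: "\<bar>pmf PS s / real K * pmf (g m s) l - pmf (k (c (m,l))) s / (real K * real L)\<bar>
      = a m s * pmf (g m s) l" if "l < L" for m s l
  proof -
    have "pmf PS s / real K * pmf (g m s) l - pmf (k (c (m,l))) s / (real K * real L)
      = - ((\<Sum>l<L. pmf (k (c (m,l))) s / (real K * real L)) - pmf PS s / real K) * pmf (g m s) l"
      unfolding gk[OF that, symmetric, of m s] by (simp add: algebra_simps sum_divide_distrib[symmetric])
    thus ?thesis unfolding a_def by (simp only: abs_mult abs_minus_cancel abs_of_nonneg[OF pmf_nonneg])
  qed
  have diff_bound: "\<bar>act h - idl h\<bar> \<le> (\<Sum>(m,s)\<in>J. \<Sum>l<L. a m s * pmf (g m s) l * h m s l)"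
    if "\<And>m s l. h m s l \<ge> 0" for h
  proof -
    have "act h - idl h = (\<Sum>(m,s)\<in>J. \<Sum>l<L. (pmf PS s / real K * pmf (g m s) l
        - pmf (k (c (m,l))) s / (real K * real L)) * h m s l)"
      by (simp add: act_def idl_def sum_subtractf[symmetric] left_diff_distrib case_prod_unfold)
    also have "\<bar>\<dots>\<bar> \<le> (\<Sum>(m,s)\<in>J. \<Sum>l<L. a m s * pmf (g m s) l * h m s l)"
      unfolding case_prod_unfold
      by (intro order_trans[OF sum_abs] sum_mono order_trans[OF sum_abs])
         (use that diff in \<open>auto simp: abs_mult\<close>)
    finally show ?thesis .
  qed
  have sum_g: "(\<Sum>l<L. pmf (g m s) l) = 1" for m s
    using gL by (intro sum_pmf_eq_1) auto
  have a_sum: "(\<Sum>(m,s)\<in>J. \<Sum>l<L. a m s * pmf (g m s) l) = dev_S c"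
    by (simp add: dev sum_distrib_left[symmetric] sum_g)
  have act_le: "act h \<le> idl h + dev_S c" if "\<And>m s l. h m s l \<ge> 0" "\<And>m s l. h m s l \<le> 1" for h
  proof -
    have "\<bar>act h - idl h\<bar> \<le> (\<Sum>(m,s)\<in>J. \<Sum>l<L. a m s * pmf (g m s) l * h m s l)"
      by (rule diff_bound) (rule that)
    also have "\<dots> \<le> (\<Sum>(m,s)\<in>J. \<Sum>l<L. a m s * pmf (g m s) l)"
      unfolding case_prod_unfold
      by (intro sum_mono mult_right_le_one_le) (auto simp: that a_def)
    finally show ?thesis using a_sum by linarith
  qed
  have idl_eq: "idl (\<lambda>m s l. h m (c (m,l)) s) = (\<Sum>i\<in>I. expct (k (c i)) (h (fst i) (c i)) / (real K * real L))" for h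
  proof -
    have "(\<Sum>i\<in>I. expct (k (c i)) (h (fst i) (c i)) / (real K * real L))
        = (\<Sum>m<K. \<Sum>l<L. expct (k (c (m,l))) (h m (c (m,l))) / (real K * real L))"
      using sum_I[of "\<lambda>m l. expct (k (c (m,l))) (h m (c (m,l))) / (real K * real L)"] by simp
    also have "\<dots> = (\<Sum>m<K. \<Sum>l<L. \<Sum>s\<in>S. pmf (k (c (m,l))) s / (real K * real L) * h m (c (m,l)) s)"
      by (simp add: expct_k_sum[OF cp] sum_divide_distrib)
    also have "\<dots> = idl (\<lambda>m s l. h m (c (m,l)) s)"
      unfolding idl_def sum_J by (intro sum.cong refl sum.swap)
    finally show ?thesis by simp
  qed
  have act_eq: "(\<Sum>(m,s)\<in>J. expct (g m s) (\<lambda>l. pmf PS s / real K * h m s l)) = act h" for h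
    unfolding act_def by (simp add: expct_eq_sum[OF finite_lessThan gL] sum_divide_distrib sum_distrib_left mult_ac)

  \<comment> \<open>A realization of \<open>F\<close> is a table of indices for the pairs in
    \<open>J\<close>; pairs outside \<open>J\<close> get index 0.\<close>
  define F where "F = Pi_pmf J 0 (\<lambda>(m,s). g m s)"
  have finF: "finite (set_pmf F)" unfolding F_def using fin_J fin_g by (intro finite_set_Pi_pmf) auto
  define e where "e = (\<lambda>m t s. measure_pmf.prob (wy t s) {y. dc y \<noteq> m})"
  define E where "E = (\<lambda>f. \<Sum>(m,s)\<in>J. pmf PS s / real K * e m (c (m, f (m,s))) s)"
  define G where "G = (\<lambda>x l z. case x of (m,s) \<Rightarrow> pmf PS s / real K * pmf (wz (c (m,l)) s) z)"
  define V where "V = (\<lambda>f. \<Sum>z\<in>Z. \<bar>(\<Sum>x\<in>J. G x (f x) z) - pmf PZ z\<bar>)"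

  have "expct F E = (\<Sum>x\<in>J. expct F (\<lambda>f. (\<lambda>l. (case x of (m,s) \<Rightarrow> pmf PS s / real K * e m (c (m, l)) s)) (f x)))"
    unfolding E_def by (subst expct_sum[OF finF]) (simp add: case_prod_unfold)
  also have "\<dots> = (\<Sum>x\<in>J. expct (case x of (m,s) \<Rightarrow> g m s)
        (\<lambda>l. case x of (m,s) \<Rightarrow> pmf PS s / real K * e m (c (m, l)) s))"
    unfolding F_def by (intro sum.cong refl expct_Pi_pmf_component[OF fin_J])
  also have "\<dots> = act (\<lambda>m s l. e m (c (m,l)) s)"
    unfolding act_eq[symmetric] by (simp add: case_prod_unfold)
  also have "\<dots> \<le> idl (\<lambda>m s l. e m (c (m,l)) s) + dev_S c"
    by (rule act_le) (auto simp: e_def)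
  also have "idl (\<lambda>m s l. e m (c (m,l)) s) = err c dc"
    unfolding idl_eq[of e] err_def ky_def
    by (simp add: prob_bind[OF fin_k[OF cp] fin_y] e_def)
  finally have EE: "expct F E \<le> err c dc + dev_S c" .

  define \<mu> where "\<mu> = (\<lambda>z. act (\<lambda>m s l. pmf (wz (c (m,l)) s) z))"
  have \<mu>_eq: "\<mu> z = (\<Sum>x\<in>J. expct (case x of (m,s) \<Rightarrow> g m s) (\<lambda>l. G x l z))" for z
    unfolding \<mu>_def act_eq[symmetric] by (simp add: G_def case_prod_unfold)
  have wz1: "(\<Sum>z\<in>Z. pmf (wz (c i) s) z) = 1" if "s \<in> S" for i s
    using fin_Z wz_Z[OF cp that] by (rule sum_pmf_eq_1)
  have swapZ: "(\<Sum>z\<in>Z. (\<Sum>(m,s)\<in>J. \<Sum>l<L. u m s l * h m s l z)) = (\<Sum>(m,s)\<in>J. \<Sum>l<L. u m s l * (\<Sum>z\<in>Z. h m s l z))"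
    for u :: "nat \<Rightarrow> 's \<Rightarrow> nat \<Rightarrow> real" and h :: "nat \<Rightarrow> 's \<Rightarrow> nat \<Rightarrow> 'z \<Rightarrow> real"
  proof -
    have "(\<Sum>z\<in>Z. (\<Sum>(m,s)\<in>J. \<Sum>l<L. u m s l * h m s l z)) = (\<Sum>(m,s)\<in>J. \<Sum>z\<in>Z. \<Sum>l<L. u m s l * h m s l z)"
      by (subst sum.swap) (simp add: case_prod_unfold)
    also have "\<dots> = (\<Sum>(m,s)\<in>J. \<Sum>l<L. \<Sum>z\<in>Z. u m s l * h m s l z)"
      unfolding case_prod_unfold by (intro sum.cong refl sum.swap)
    finally show ?thesis by (simp add: sum_distrib_left)
  qed
  have PSK: "(\<Sum>(m,s)\<in>J. pmf PS s / real K) = 1"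
    using KL by (simp add: sum_J sum_divide_distrib[symmetric] sum_PS)
  have \<mu>1: "(\<Sum>z\<in>Z. \<mu> z) = 1"
  proof -
    have "(\<Sum>z\<in>Z. \<mu> z) = (\<Sum>(m,s)\<in>J. \<Sum>l<L. pmf PS s / real K * pmf (g m s) l * (\<Sum>z\<in>Z. pmf (wz (c (m,l)) s) z))"
      unfolding \<mu>_def act_def by (rule swapZ)
    also have "\<dots> = (\<Sum>(m,s)\<in>J. \<Sum>l<L. pmf PS s / real K * pmf (g m s) l)"
      unfolding case_prod_unfold
      by (intro sum.cong refl, subst wz1) (auto simp: J_def)
    also have "\<dots> = (\<Sum>(m,s)\<in>J. pmf PS s / real K)"
      by (simp only: sum_distrib_left[symmetric] sum_g mult_1_right)
    finally show ?thesis by (simp add: PSK)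
  qed
  have "(\<Sum>z\<in>Z. \<bar>\<mu> z - idl (\<lambda>m s l. pmf (wz (c (m,l)) s) z)\<bar>)
     \<le> (\<Sum>z\<in>Z. (\<Sum>(m,s)\<in>J. \<Sum>l<L. a m s * pmf (g m s) l * pmf (wz (c (m,l)) s) z))"
    unfolding \<mu>_def by (intro sum_mono diff_bound) auto
  also have "\<dots> = (\<Sum>(m,s)\<in>J. \<Sum>l<L. a m s * pmf (g m s) l * (\<Sum>z\<in>Z. pmf (wz (c (m,l)) s) z))"
    by (rule swapZ)
  also have "\<dots> = (\<Sum>(m,s)\<in>J. \<Sum>l<L. a m s * pmf (g m s) l)"
    unfolding case_prod_unfold by (intro sum.cong refl, subst wz1) (auto simp: J_def)
  finally have tv1: "(\<Sum>z\<in>Z. \<bar>\<mu> z - idl (\<lambda>m s l. pmf (wz (c (m,l)) s) z)\<bar>) \<le> dev_S c"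
    by (simp only: a_sum)
  have "idl (\<lambda>m s l. pmf (wz (c (m,l)) s) z) = (\<Sum>i\<in>I. pmf (kz (c i)) z / (real K * real L))" for z
    using idl_eq[of "\<lambda>m t s. pmf (wz t s) z"] by (simp add: kz_def pmf_bind)
  hence tv2: "(\<Sum>z\<in>Z. \<bar>idl (\<lambda>m s l. pmf (wz (c (m,l)) s) z) - pmf PZ z\<bar>) = dev_Z c"
    by (simp add: dev_Z_def)

  \<comment> \<open>Soft covering with the pairs \<open>(m, s)\<close> as indices and
    \<open>l\<close> as the codeword. The mean \<open>\<mu>\<close> is only close to
    \<open>PZ\<close>, which serves as the reference.\<close>
  have "expct F (\<lambda>f. \<Sum>z\<in>Z. \<bar>(\<Sum>x\<in>J. G x (f x) z) - \<mu> z\<bar>)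
    \<le> 2 * (\<Sum>x\<in>J. expct (case x of (m,s) \<Rightarrow> g m s) (\<lambda>l. \<Sum>z\<in>Z. G x l z * of_bool (G x l z > \<theta> * pmf PZ z))) + sqrt \<theta>"
    unfolding F_def
    by (rule soft_covering[OF fin_J fin_Z]) (use fin_g \<mu>_eq \<mu>1 sum_PZ \<theta> in \<open>auto simp: G_def\<close>)
  also have "(\<Sum>x\<in>J. expct (case x of (m,s) \<Rightarrow> g m s) (\<lambda>l. \<Sum>z\<in>Z. G x l z * of_bool (G x l z > \<theta> * pmf PZ z)))
     = (\<Sum>(m,s)\<in>J. expct (g m s) (\<lambda>l. pmf PS s / real K * atyp \<theta> (c (m,l)) s))"
    unfolding case_prod_unfold
  proof (intro sum.cong refl expct_cong)
    fix x l assume "x \<in> J"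
    then obtain m s where x: "x = (m,s)" "s \<in> S" by (auto simp: J_def)
    have "(\<Sum>z\<in>Z. G x l z * of_bool (G x l z > \<theta> * pmf PZ z))
       = (\<Sum>z\<in>Z. pmf PS s / real K * (pmf (wz (c (m,l)) s) z
            * of_bool (pmf PS s * pmf (wz (c (m,l)) s) z > real K * \<theta> * pmf PZ z)))"
      using KL by (intro sum.cong refl) (simp add: G_def x field_simps)
    also have "\<dots> = pmf PS s / real K * atyp \<theta> (c (m,l)) s"
      unfolding atyp_def prob_eq_sum[OF fin_Z wz_Z[OF cp x(2)]]
      by (simp add: sum_distrib_left)
    finally show "(\<Sum>z\<in>Z. G x l z * of_bool (G x l z > \<theta> * pmf PZ z))
       = pmf PS (snd x) / real K * atyp \<theta> (c (fst x,l)) (snd x)"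
      by (simp add: x)
  qed
  also have "\<dots> = act (\<lambda>m s l. atyp \<theta> (c (m,l)) s)" by (rule act_eq)
  \<comment> \<open>The overflow arises under the true law; passing to the ideal law costs
    \<open>dev_S c\<close> and produces a quantity whose codebook average is
    \<open>cover_SZ \<theta>\<close>.\<close>
  also have "\<dots> \<le> idl (\<lambda>m s l. atyp \<theta> (c (m,l)) s) + dev_S c"
    by (rule act_le) (auto simp: atyp_def)
  also have "idl (\<lambda>m s l. atyp \<theta> (c (m,l)) s) = dev_SZ \<theta> c"
    using idl_eq[of "\<lambda>m. atyp \<theta>"] by (simp add: dev_SZ_def)
  finally have tv3: "expct F (\<lambda>f. \<Sum>z\<in>Z. \<bar>(\<Sum>x\<in>J. G x (f x) z) - \<mu> z\<bar>)
    \<le> 2 * (dev_SZ \<theta> c + dev_S c) + sqrt \<theta>"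
    by simp
  have "expct F V \<le> expct F (\<lambda>f. (\<Sum>z\<in>Z. \<bar>(\<Sum>x\<in>J. G x (f x) z) - \<mu> z\<bar>) + (dev_S c + dev_Z c))"
  proof (rule expct_mono[OF finF])
    fix f
    have "V f \<le> (\<Sum>z\<in>Z. \<bar>(\<Sum>x\<in>J. G x (f x) z) - \<mu> z\<bar>
        + (\<bar>\<mu> z - idl (\<lambda>m s l. pmf (wz (c (m,l)) s) z)\<bar>
        + \<bar>idl (\<lambda>m s l. pmf (wz (c (m,l)) s) z) - pmf PZ z\<bar>))"
      unfolding V_def by (intro sum_mono) linarith
    also have "\<dots> \<le> (\<Sum>z\<in>Z. \<bar>(\<Sum>x\<in>J. G x (f x) z) - \<mu> z\<bar>) + (dev_S c + dev_Z c)"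
      using tv1 tv2 by (simp add: sum.distrib)
    finally show "V f \<le> (\<Sum>z\<in>Z. \<bar>(\<Sum>x\<in>J. G x (f x) z) - \<mu> z\<bar>) + (dev_S c + dev_Z c)" .
  qed
  hence "expct F V \<le> 2 * (dev_SZ \<theta> c + dev_S c) + sqrt \<theta> + (dev_S c + dev_Z c)"
    using tv3 by (simp add: expct_add[OF finF])
  \<comment> \<open>The coefficient 4 of \<open>dev_S c\<close> collects one from the error, two
    from the doubled overflow and one from comparing \<open>\<mu>\<close> with the ideal law of
    \<open>z\<close>.\<close>
  hence "expct F (\<lambda>f. E f + V f) \<le> 4 * dev_S c + dev_Z c + err c dc + 2 * dev_SZ \<theta> c + sqrt \<theta>"
    using EE by (simp add: expct_add[OF finF])
  then obtain f where "E f + V f \<le> 4 * dev_S c + dev_Z c + err c dc + 2 * dev_SZ \<theta> c + sqrt \<theta>"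
    using ex_le_expct[OF finF] by blast
  thus ?thesis
    by (intro exI[of _ "\<lambda>m s. c (m, f (m,s))"]) (simp add: cp E_def V_def G_def e_def case_prod_unfold)
qed

text \<open>One weighted sum of all codebook functionals is averaged, so a single codebook is good
  for all of them simultaneously.\<close>

theorem one_shot:
  assumes "\<alpha> \<ge> 0" "\<beta> \<ge> 0" "\<gamma> > 0" "\<theta> \<ge> 0"
  shows "\<exists>f dc. (\<forall>m s. f m s \<in> set_pmf p) \<and>
     (\<Sum>(m,s)\<in>J. pmf PS s / real K * measure_pmf.prob (wy (f m s) s) {y. dc y \<noteq> m})
     + (\<Sum>z\<in>Z. \<bar>(\<Sum>(m,s)\<in>J. pmf PS s / real K * pmf (wz (f m s) s) z) - pmf PZ z\<bar>)
     \<le> 4 * (2 * cover_S \<alpha> + sqrt \<alpha>) + (2 * cover_Z \<beta> + sqrt \<beta>)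
       + (pack_Y \<gamma> + real K * real L / \<gamma>) + 2 * cover_SZ \<theta> + sqrt \<theta>"
proof -
  have "expct codebook (\<lambda>c. 4 * dev_S c + dev_Z c + err c (dec \<gamma> c) + 2 * dev_SZ \<theta> c)
     = 4 * expct codebook dev_S + expct codebook dev_Z + expct codebook (\<lambda>c. err c (dec \<gamma> c)) + 2 * expct codebook (dev_SZ \<theta>)"
    by (simp add: expct_add[OF fin_codebook])
  also have "\<dots> \<le> 4 * (2 * cover_S \<alpha> + sqrt \<alpha>) + (2 * cover_Z \<beta> + sqrt \<beta>)
       + (pack_Y \<gamma> + real K * real L / \<gamma>) + 2 * cover_SZ \<theta>"
    using assms by (intro add_mono mult_left_mono expct_dev_S expct_dev_Z expct_err) (auto simp: expct_dev_SZ)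
  finally obtain c where "c \<in> set_pmf codebook" and le: "4 * dev_S c + dev_Z c + err c (dec \<gamma> c) + 2 * dev_SZ \<theta> c
      \<le> 4 * (2 * cover_S \<alpha> + sqrt \<alpha>) + (2 * cover_Z \<beta> + sqrt \<beta>)
       + (pack_Y \<gamma> + real K * real L / \<gamma>) + 2 * cover_SZ \<theta>"
    using ex_le_expct[OF fin_codebook] by blast
  from ex_encoder[OF this(1) assms(4), of "dec \<gamma> c"] obtain f where
    "\<forall>m s. f m s \<in> set_pmf p" and
    "(\<Sum>(m,s)\<in>J. pmf PS s / real K * measure_pmf.prob (wy (f m s) s) {y. dec \<gamma> c y \<noteq> m})
     + (\<Sum>z\<in>Z. \<bar>(\<Sum>(m,s)\<in>J. pmf PS s / real K * pmf (wz (f m s) s) z) - pmf PZ z\<bar>)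
     \<le> 4 * dev_S c + dev_Z c + err c (dec \<gamma> c) + 2 * dev_SZ \<theta> c + sqrt \<theta>"
    by blast
  note this(1) and order_trans[OF this(2) add_right_mono[OF le]]
  thus ?thesis by blast
qed

end

section \<open>Memoryless extensions and exponential tails\<close>

primrec seq_pmf :: "('a \<Rightarrow> 'b pmf) \<Rightarrow> 'a list \<Rightarrow> 'b list pmf" where
  "seq_pmf k [] = return_pmf []"
| "seq_pmf k (a # as) = bind_pmf (k a) (\<lambda>b. map_pmf (\<lambda>bs. b # bs) (seq_pmf k as))"

lemma set_iid_pmf: "set_pmf (iid_pmf n p) = {xs. length xs = n \<and> set xs \<subseteq> set_pmf p}"
proof (induction n)
  case (Suc n)
  show ?case
  proof (intro set_eqI)
    fix xs show "xs \<in> set_pmf (iid_pmf (Suc n) p) \<longleftrightarrow> xs \<in> {xs. length xs = Suc n \<and> set xs \<subseteq> set_pmf p}"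
      by (cases xs) (auto simp: Suc)
  qed
qed auto

lemma finite_set_iid_pmf: "finite (set_pmf p) \<Longrightarrow> finite (set_pmf (iid_pmf n p))"
  using finite_lists_length_eq[of "set_pmf p" n] by (simp add: set_iid_pmf conj_commute)

lemma length_seq_pmf: "bs \<in> set_pmf (seq_pmf k as) \<Longrightarrow> length bs = length as"
  by (induction as arbitrary: bs) auto

lemma finite_set_seq_pmf: "(\<And>a. finite (set_pmf (k a))) \<Longrightarrow> finite (set_pmf (seq_pmf k as))"
  by (induction as) auto

lemma pmf_bind_map_Cons: "pmf (bind_pmf p (\<lambda>a. map_pmf (\<lambda>as. a # as) q)) (x # xs) = pmf p x * pmf q xs"
proof -
  have "bind_pmf p (\<lambda>a. map_pmf (\<lambda>as. a # as) q) = map_pmf (\<lambda>(a, as). a # as) (pair_pmf p q)"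
    by (simp add: pair_pmf_def map_bind_pmf map_pmf_def bind_assoc_pmf bind_return_pmf)
  also have "pmf \<dots> ((\<lambda>(a, as). a # as) (x, xs)) = pmf (pair_pmf p q) (x, xs)"
    by (rule pmf_map_inj') (auto simp: inj_on_def)
  finally show ?thesis by (simp add: pmf_pair)
qed

text \<open>Here and in \<open>pmf_seq_map\<close> the sequences are images of one list
  \<open>l\<close> of single-letter tuples, so all likelihoods become products over the same
  \<open>l\<close>, as \<open>likelihood_ratio_tail\<close> expects.\<close>

lemma pmf_iid_map: "pmf (iid_pmf (length l) q) (map g l) = prod_list (map (\<lambda>x. pmf q (g x)) l)"
  by (induction l) (simp_all add: pmf_bind_map_Cons)

lemma pmf_seq_map: "pmf (seq_pmf k (map f l)) (map g l) = prod_list (map (\<lambda>x. pmf (k (f x)) (g x)) l)"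
  by (induction l) (simp_all add: pmf_bind_map_Cons)

lemma bind_iid_seq: "bind_pmf (iid_pmf n p) (seq_pmf k) = iid_pmf n (bind_pmf p k)"
proof (induction n)
  case (Suc n)
  have "bind_pmf (iid_pmf (Suc n) p) (seq_pmf k)
    = bind_pmf p (\<lambda>t. bind_pmf (iid_pmf n p) (\<lambda>ts. bind_pmf (k t) (\<lambda>s. map_pmf ((#) s) (seq_pmf k ts))))"
    by (simp add: bind_assoc_pmf bind_map_pmf)
  also have "\<dots> = bind_pmf p (\<lambda>t. bind_pmf (k t) (\<lambda>s. bind_pmf (iid_pmf n p) (\<lambda>ts. map_pmf ((#) s) (seq_pmf k ts))))"
    by (subst bind_commute_pmf) simp
  finally show ?case by (simp add: bind_assoc_pmf map_bind_pmf[symmetric] Suc)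
qed (simp add: bind_return_pmf)

lemma bind_seq_seq:
  "bind_pmf (seq_pmf k ts) (\<lambda>ss. seq_pmf w (zip ts ss)) = seq_pmf (\<lambda>t. bind_pmf (k t) (\<lambda>s. w (t, s))) ts"
proof (induction ts)
  case (Cons t ts)
  have "bind_pmf (seq_pmf k (t # ts)) (\<lambda>ss. seq_pmf w (zip (t # ts) ss))
    = bind_pmf (k t) (\<lambda>s. bind_pmf (seq_pmf k ts) (\<lambda>ss. bind_pmf (w (t, s)) (\<lambda>z. map_pmf ((#) z) (seq_pmf w (zip ts ss)))))"
    by (simp add: bind_assoc_pmf bind_map_pmf)
  also have "\<dots> = bind_pmf (k t) (\<lambda>s. bind_pmf (w (t, s)) (\<lambda>z. bind_pmf (seq_pmf k ts) (\<lambda>ss. map_pmf ((#) z) (seq_pmf w (zip ts ss)))))"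
    by (subst bind_commute_pmf) simp
  finally show ?case by (simp add: bind_assoc_pmf map_bind_pmf[symmetric] Cons)
qed (simp add: bind_return_pmf)

definition joint3 :: "'t pmf \<Rightarrow> ('t \<Rightarrow> 's pmf) \<Rightarrow> ('t \<times> 's \<Rightarrow> 'z pmf) \<Rightarrow> ('t \<times> 's \<times> 'z) pmf" where
  "joint3 p k w = bind_pmf p (\<lambda>t. bind_pmf (k t) (\<lambda>s. map_pmf (\<lambda>z. (t, s, z)) (w (t, s))))"

text \<open>Transposition relates a triple of sequences to a list of triples. Independent draws
  commute, so the first letters \<open>t\<close>, \<open>s\<close>, \<open>z\<close> can be drawn
  before all the tails, to which the induction hypothesis applies.\<close>

lemma iid_joint3:
  "bind_pmf (iid_pmf n p) (\<lambda>ts. bind_pmf (seq_pmf k ts) (\<lambda>ss. map_pmf (\<lambda>zs. (ts, ss, zs)) (seq_pmf w (zip ts ss))))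
   = map_pmf (\<lambda>l. (map fst l, map (fst \<circ> snd) l, map (snd \<circ> snd) l)) (iid_pmf n (joint3 p k w))"
proof (induction n)
  case (Suc n)
  let ?C = "\<lambda>t s z (ts, ss, zs). (t # ts, s # ss, z # zs)"
  have "bind_pmf (iid_pmf (Suc n) p) (\<lambda>ts. bind_pmf (seq_pmf k ts) (\<lambda>ss. map_pmf (\<lambda>zs. (ts, ss, zs)) (seq_pmf w (zip ts ss))))
   = bind_pmf p (\<lambda>t. bind_pmf (iid_pmf n p) (\<lambda>ts. bind_pmf (k t) (\<lambda>s. bind_pmf (seq_pmf k ts)
       (\<lambda>ss. bind_pmf (w (t, s)) (\<lambda>z. map_pmf (?C t s z) (map_pmf (\<lambda>zs. (ts, ss, zs)) (seq_pmf w (zip ts ss))))))))"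
    by (simp add: bind_assoc_pmf bind_map_pmf map_bind_pmf pmf.map_comp o_def)
  also have "\<dots> = bind_pmf p (\<lambda>t. bind_pmf (k t) (\<lambda>s. bind_pmf (iid_pmf n p) (\<lambda>ts. bind_pmf (w (t, s)) (\<lambda>z. bind_pmf (seq_pmf k ts)
       (\<lambda>ss. map_pmf (?C t s z) (map_pmf (\<lambda>zs. (ts, ss, zs)) (seq_pmf w (zip ts ss))))))))"
    by (subst bind_commute_pmf, subst (3) bind_commute_pmf) simp
  also have "\<dots> = bind_pmf p (\<lambda>t. bind_pmf (k t) (\<lambda>s. bind_pmf (w (t, s)) (\<lambda>z. bind_pmf (iid_pmf n p) (\<lambda>ts. bind_pmf (seq_pmf k ts)
       (\<lambda>ss. map_pmf (?C t s z) (map_pmf (\<lambda>zs. (ts, ss, zs)) (seq_pmf w (zip ts ss))))))))"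
    by (subst (3) bind_commute_pmf) simp
  also have "\<dots> = bind_pmf p (\<lambda>t. bind_pmf (k t) (\<lambda>s. bind_pmf (w (t, s)) (\<lambda>z. map_pmf (?C t s z)
       (map_pmf (\<lambda>l. (map fst l, map (fst \<circ> snd) l, map (snd \<circ> snd) l)) (iid_pmf n (joint3 p k w))))))"
    by (simp only: map_bind_pmf[symmetric] Suc[symmetric])
  finally show ?case
    by (simp add: joint3_def bind_assoc_pmf bind_map_pmf map_bind_pmf pmf.map_comp o_def)
qed (simp add: bind_return_pmf)

section \<open>Exponential tail bounds\<close>

lemma expct_iid_prod_list:
  assumes "finite (set_pmf P)"
  shows "expct (iid_pmf n P) (\<lambda>xs. prod_list (map e xs)) = expct P e ^ n"
proof (induction n)
  case (Suc n)
  have "expct (iid_pmf (Suc n) P) (\<lambda>xs. prod_list (map e xs))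
      = expct P (\<lambda>x. expct (iid_pmf n P) (\<lambda>xs. e x * prod_list (map e xs)))"
    using assms by (simp add: expct_bind finite_set_iid_pmf)
  also have "\<dots> = expct P e * expct P e ^ n"
    by (simp add: Suc)
  finally show ?case by simp
qed simp

text \<open>Markov's inequality for the exponential of \<open>u\<close> times the centred sum. The
  function \<open>\<phi>\<close> has value 1 and derivative \<open>expct P a - \<tau> < 0\<close> at
  0, so \<open>\<phi> u < 1\<close> for some small \<open>u > 0\<close>, and independence raises
  this to the power \<open>n\<close>.\<close>

lemma chernoff_iid:
  assumes fin: "finite (set_pmf P)" and mean: "expct P a < \<tau>"
  shows "\<exists>\<rho>. 0 \<le> \<rho> \<and> \<rho> < 1 \<and>
    (\<forall>n. measure_pmf.prob (iid_pmf n P) {xs. sum_list (map a xs) \<ge> real n * \<tau>} \<le> \<rho> ^ n)"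
proof -
  define \<phi> where "\<phi> = (\<lambda>u. \<Sum>x\<in>set_pmf P. pmf P x * exp (u * (a x - \<tau>)))"
  have "(\<phi> has_real_derivative (\<Sum>x\<in>set_pmf P. pmf P x * (exp (0 * (a x - \<tau>)) * (a x - \<tau>)))) (at 0)"
    unfolding \<phi>_def by (intro DERIV_sum DERIV_cmult) (auto intro!: derivative_eq_intros)
  moreover have "(\<Sum>x\<in>set_pmf P. pmf P x * (exp (0 * (a x - \<tau>)) * (a x - \<tau>))) = expct P a - \<tau>"
    using fin by (simp add: expct_eq_sum[OF fin order_refl] right_diff_distrib sum_subtractf
        sum_distrib_right[symmetric] sum_pmf_eq_1)
  ultimately have "(\<phi> has_real_derivative (expct P a - \<tau>)) (at 0)" by simp
  from DERIV_neg_dec_right[OF this] mean obtain d where d: "d > 0" "\<And>h. h > 0 \<Longrightarrow> h < d \<Longrightarrow> \<phi> (0 + h) < \<phi> 0"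
    by auto
  define u where "u = d / 2"
  have u: "u > 0" "\<phi> u < 1"
    using d(1) d(2)[of u] fin by (auto simp: u_def \<phi>_def sum_pmf_eq_1)
  have \<phi>: "\<phi> u = expct P (\<lambda>x. exp (u * (a x - \<tau>)))"
    by (simp add: \<phi>_def expct_eq_sum[OF fin order_refl])
  have "measure_pmf.prob (iid_pmf n P) {xs. sum_list (map a xs) \<ge> real n * \<tau>} \<le> \<phi> u ^ n" for n
  proof -
    have finn: "finite (set_pmf (iid_pmf n P))" using fin by (rule finite_set_iid_pmf)
    have prod: "prod_list (map (\<lambda>x. exp (u * (a x - \<tau>))) xs) = exp (u * (sum_list (map a xs) - real (length xs) * \<tau>))" for xs
      by (induction xs) (simp_all add: exp_add[symmetric] algebra_simps)
    have "measure_pmf.prob (iid_pmf n P) {xs. sum_list (map a xs) \<ge> real n * \<tau>}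
        \<le> expct (iid_pmf n P) (\<lambda>xs. prod_list (map (\<lambda>x. exp (u * (a x - \<tau>))) xs))"
      unfolding prob_eq_expct prod using u(1) by (intro expct_mono[OF finn]) (auto simp: set_iid_pmf)
    thus ?thesis by (simp add: expct_iid_prod_list[OF fin] \<phi>)
  qed
  moreover have "\<phi> u \<ge> 0" unfolding \<phi> by (intro Bochner_Integration.integral_nonneg) auto
  ultimately show ?thesis using u(2) by (intro exI[of _ "\<phi> u"]) auto
qed

text \<open>On the support, the ratio of the two products is 2 to a sum of i.i.d. log-ratios. The
  event avoids division and allows every \<open>c\<close> above the exponential, so that rounded
  codebook sizes can be inserted directly.\<close>

lemma likelihood_ratio_tail:
  assumes fin: "finite (set_pmf P)"
    and u: "\<And>x. x \<in> set_pmf P \<Longrightarrow> u x > (0::real)" and v: "\<And>x. x \<in> set_pmf P \<Longrightarrow> v x > 0"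
    and mean: "expct P (\<lambda>x. log 2 (u x / v x)) < \<tau>"
  shows "\<exists>\<rho>. 0 \<le> \<rho> \<and> \<rho> < 1 \<and> (\<forall>n c. c \<ge> 2 powr (real n * \<tau>) \<longrightarrow>
    measure_pmf.prob (iid_pmf n P) {l. prod_list (map u l) \<ge> c * prod_list (map v l)} \<le> \<rho> ^ n)"
proof -
  let ?a = "\<lambda>x. log 2 (u x / v x)"
  obtain \<rho> where \<rho>: "0 \<le> \<rho>" "\<rho> < 1"
    "\<And>n. measure_pmf.prob (iid_pmf n P) {xs. sum_list (map ?a xs) \<ge> real n * \<tau>} \<le> \<rho> ^ n"
    using chernoff_iid[OF fin mean] by blast
  have ratio: "prod_list (map v l) > 0 \<and> prod_list (map u l) = 2 powr (sum_list (map ?a l)) * prod_list (map v l)"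
    if "set l \<subseteq> set_pmf P" for l
    using that
  proof (induction l)
    case (Cons x l)
    have "2 powr ?a x = u x / v x" using u[of x] v[of x] Cons.prems by simp
    thus ?case using Cons v[of x] by (auto simp: powr_add mult_ac)
  qed simp
  have "measure_pmf.prob (iid_pmf n P) {l. prod_list (map u l) \<ge> c * prod_list (map v l)} \<le> \<rho> ^ n"
    if c: "c \<ge> 2 powr (real n * \<tau>)" for n c
  proof -
    have "measure_pmf.prob (iid_pmf n P) {l. prod_list (map u l) \<ge> c * prod_list (map v l)}
        \<le> measure_pmf.prob (iid_pmf n P) {xs. sum_list (map ?a xs) \<ge> real n * \<tau>}"
      unfolding prob_eq_expct
    proof (rule expct_mono[OF finite_set_iid_pmf[OF fin]])
      fix l assume "l \<in> set_pmf (iid_pmf n P)"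
      hence l: "set l \<subseteq> set_pmf P" by (simp add: set_iid_pmf)
      have "real n * \<tau> \<le> sum_list (map ?a l)" if "prod_list (map u l) \<ge> c * prod_list (map v l)"
      proof -
        have "2 powr (sum_list (map ?a l)) \<ge> c" using that ratio[OF l] by simp
        hence "2 powr (real n * \<tau>) \<le> 2 powr (sum_list (map ?a l))" using c by linarith
        thus ?thesis by simp
      qed
      thus "of_bool (l \<in> {l. prod_list (map u l) \<ge> c * prod_list (map v l)})
          \<le> (of_bool (l \<in> {xs. sum_list (map ?a xs) \<ge> real n * \<tau>}) :: real)" by auto
    qed
    thus ?thesis using \<rho>(3)[of n] by linarith
  qed
  thus ?thesis using \<rho> by blast
qed

lemma prob_mono_support:
  assumes "finite (set_pmf p)" "\<And>x. x \<in> set_pmf p \<Longrightarrow> x \<in> A \<Longrightarrow> x \<in> B"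
  shows "measure_pmf.prob p A \<le> measure_pmf.prob p B"
  unfolding prob_eq_expct using assms by (intro expct_mono) auto

lemma pmf_bind_ge:
  assumes "finite (set_pmf p)"
  shows "pmf p a * pmf (f a) x \<le> pmf (bind_pmf p f) x"
proof -
  have "pmf p a * pmf (f a) x = (\<Sum>b\<in>{a}. pmf p b * pmf (f b) x)" by simp
  also have "\<dots> \<le> (\<Sum>b\<in>insert a (set_pmf p). pmf p b * pmf (f b) x)"
    using assms by (intro sum_mono2) auto
  also have "\<dots> = pmf (bind_pmf p f) x"
    using assms by (intro pmf_bind_sum[symmetric]) auto
  finally show ?thesis .
qed

lemma num_msgs_ge: "2 powr (real n * R) \<le> real (num_msgs n R)"
  unfolding num_msgs_def by linarith

lemma num_msgs_pos: "num_msgs n R > 0"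
proof -
  have "0 < 2 powr (real n * R)" by simp
  hence "0 < real (num_msgs n R)" using num_msgs_ge[of n R] by linarith
  thus ?thesis by simp
qed

text \<open>Rounding up at most doubles the power, which is at least 1 for nonnegative
  \<open>R\<close>.\<close>

lemma num_msgs_le:
  assumes "R \<ge> 0"
  shows "real (num_msgs n R) \<le> 2 * 2 powr (real n * R)"
proof -
  have "1 \<le> 2 powr (real n * R)" using assms by (simp add: ge_one_powr_ge_zero)
  moreover have "real (num_msgs n R) \<le> 2 powr (real n * R) + 1"
    unfolding num_msgs_def using calculation by linarith
  ultimately show ?thesis by linarith
qed

lemma prob_iid_joint3:
  fixes k :: "'t \<Rightarrow> 's::finite pmf" and w :: "'t \<times> 's \<Rightarrow> 'z::finite pmf"
  assumes "finite (set_pmf p)"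
  shows "expct (iid_pmf n p) (\<lambda>ts. expct (seq_pmf k ts) (\<lambda>ss. measure_pmf.prob (seq_pmf w (zip ts ss)) {zs. X ts ss zs}))
    = measure_pmf.prob (iid_pmf n (joint3 p k w)) {l. X (map fst l) (map (fst \<circ> snd) l) (map (snd \<circ> snd) l)}"
proof -
  have fin: "finite (set_pmf (iid_pmf n p))" "finite (set_pmf (seq_pmf k ts))" "finite (set_pmf (seq_pmf w as))" for ts as
    using assms by (auto intro: finite_set_iid_pmf finite_set_seq_pmf)
  have "measure_pmf.prob (iid_pmf n (joint3 p k w)) {l. X (map fst l) (map (fst \<circ> snd) l) (map (snd \<circ> snd) l)}
    = measure_pmf.prob (map_pmf (\<lambda>l. (map fst l, map (fst \<circ> snd) l, map (snd \<circ> snd) l)) (iid_pmf n (joint3 p k w)))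
        {(ts, ss, zs). X ts ss zs}"
    by (simp add: vimage_def)
  also have "\<dots> = expct (iid_pmf n p) (\<lambda>ts. expct (seq_pmf k ts) (\<lambda>ss. measure_pmf.prob (seq_pmf w (zip ts ss)) {zs. X ts ss zs}))"
    unfolding iid_joint3[symmetric] using fin by (simp add: prob_bind vimage_def)
  finally show ?thesis by simp
qed

section \<open>Block codes\<close>

locale single_letter =
  fixes PT :: "'t pmf" and kS :: "'t \<Rightarrow> 's::finite pmf"
    and wY :: "'t \<times> 's \<Rightarrow> 'y::finite pmf" and wZ :: "'t \<times> 's \<Rightarrow> 'z::finite pmf"
  assumes fin_T: "finite (set_pmf PT)"
begin

definition "QS = bind_pmf PT kS"
definition "kY t = bind_pmf (kS t) (\<lambda>s. wY (t, s))"
definition "kZ t = bind_pmf (kS t) (\<lambda>s. wZ (t, s))"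
definition "QY = bind_pmf PT kY"
definition "QZ = bind_pmf PT kZ"

text \<open>These are I(T;S), I(T;Z) and I(T;Y) in bits, each as the mean log-ratio of a kernel to
  its output marginal, the form to which \<open>likelihood_ratio_tail\<close> applies.\<close>

definition "iS = expct (joint3 PT kS wZ) (\<lambda>(t, s, z). log 2 (pmf (kS t) s / pmf QS s))"
definition "iZ = expct (joint3 PT kS wZ) (\<lambda>(t, s, z). log 2 (pmf (kZ t) z / pmf QZ z))"
definition "iY = expct (joint3 PT kS wY) (\<lambda>(t, s, y). log 2 (pmf (kY t) y / pmf QY y))"

lemma fin_joint: "finite (set_pmf (joint3 PT kS (w :: _ \<Rightarrow> 'w::finite pmf)))"
  using fin_T by (simp add: joint3_def)

lemma joint_pos:
  assumes "(t, s, z) \<in> set_pmf (joint3 PT kS w)"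
  shows "pmf (kS t) s > 0" "pmf QS s > 0"
    "pmf (bind_pmf (kS t) (\<lambda>s. w (t, s))) z > 0"
    "pmf (bind_pmf PT (\<lambda>t. bind_pmf (kS t) (\<lambda>s. w (t, s)))) z > 0"
  using assms by (auto simp: joint3_def QS_def pmf_positive_iff)

lemma joint_pos_Z:
  assumes "(t, s, z) \<in> set_pmf (joint3 PT kS wZ)"
  shows "pmf (kZ t) z > 0" "pmf QZ z > 0"
  using joint_pos(3,4)[OF assms] by (simp_all add: kZ_def[abs_def] QZ_def)

lemma joint_pos_Y:
  assumes "(t, s, y) \<in> set_pmf (joint3 PT kS wY)"
  shows "pmf (kY t) y > 0" "pmf QY y > 0"
  using joint_pos(3,4)[OF assms] by (simp_all add: kY_def[abs_def] QY_def)

text \<open>Gibbs' inequality for each \<open>kS t\<close> against \<open>QS\<close>. It makes the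
  rate \<open>Rl\<close> of the index \<open>l\<close> nonnegative, as \<open>num_msgs_le\<close>
  requires.\<close>

lemma iS_nonneg: "iS \<ge> 0"
proof -
  have "0 \<le> expct (kS t) (\<lambda>s. log 2 (pmf (kS t) s / pmf QS s))" if t: "t \<in> set_pmf PT" for t
  proof -
    have "0 \<le> (1 - (\<Sum>s\<in>set_pmf (kS t). pmf QS s)) / ln 2"
      unfolding measure_measure_pmf_finite[OF finite, symmetric] by simp
    also have "\<dots> = (\<Sum>s\<in>set_pmf (kS t). (pmf (kS t) s - pmf QS s) / ln 2)"
      by (simp add: sum_divide_distrib[symmetric] sum_subtractf sum_pmf_eq_1)
    also have "\<dots> \<le> (\<Sum>s\<in>set_pmf (kS t). pmf (kS t) s * log 2 (pmf (kS t) s / pmf QS s))"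
    proof (rule sum_mono)
      fix s assume s: "s \<in> set_pmf (kS t)"
      have pos: "pmf (kS t) s > 0" "pmf QS s > 0"
        using s t by (auto simp: QS_def pmf_positive_iff)
      have "ln (pmf QS s / pmf (kS t) s) \<le> pmf QS s / pmf (kS t) s - 1"
        using pos by (intro ln_le_minus_one) auto
      hence "pmf (kS t) s * (1 - pmf QS s / pmf (kS t) s) \<le> pmf (kS t) s * ln (pmf (kS t) s / pmf QS s)"
        using pos by (intro mult_left_mono) (auto simp: ln_div)
      thus "(pmf (kS t) s - pmf QS s) / ln 2 \<le> pmf (kS t) s * log 2 (pmf (kS t) s / pmf QS s)"
        using pos by (simp add: log_def divide_right_mono right_diff_distrib)
    qed
    finally show ?thesis by (simp add: expct_eq_sum[OF finite order_refl])
  qed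
  hence "0 \<le> expct PT (\<lambda>t. expct (kS t) (\<lambda>s. log 2 (pmf (kS t) s / pmf QS s)))"
    by (intro integral_nonneg_AE) (auto simp: AE_measure_pmf_iff)
  also have "\<dots> = iS"
    unfolding iS_def joint3_def using fin_T by (simp add: expct_bind)
  finally show ?thesis .
qed

text \<open>With \<open>Rl\<close> the rate of the index \<open>l\<close>, the tails demand
  \<open>Rl > iS\<close> for the state, \<open>R + Rl > iZ\<close> for the warden,
  \<open>R + Rl < iY\<close> for decoding, and \<open>R > iZ - iS\<close> for fixing
  \<open>l\<close> as a function of \<open>(m, s)\<close>. The hypotheses leave room for such an
  \<open>Rl\<close>.\<close>

theorem block_codes:
  assumes R: "0 < R" "iZ - iS < R" "R < iY - iS"
  shows "\<exists>C \<rho>. 0 \<le> \<rho> \<and> \<rho> < 1 \<and> (\<forall>n. \<exists>f dc. (\<forall>m s. length (f m s) = n) \<and>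
    (\<Sum>(m,s)\<in>{..<num_msgs n R} \<times> {s. length s = n}. pmf (iid_pmf n QS) s / real (num_msgs n R)
        * measure_pmf.prob (seq_pmf wY (zip (f m s) s)) {y. dc y \<noteq> m})
    + (\<Sum>z\<in>{z. length z = n}. \<bar>(\<Sum>(m,s)\<in>{..<num_msgs n R} \<times> {s. length s = n}.
          pmf (iid_pmf n QS) s / real (num_msgs n R) * pmf (seq_pmf wZ (zip (f m s) s)) z) - pmf (iid_pmf n QZ) z\<bar>)
    \<le> C * \<rho> ^ n)"
proof -
  \<comment> \<open>The slack \<open>4 * \<delta>\<close> below \<open>iY - iS\<close> is divided so
    that \<open>Rl = iS + 2 * \<delta>\<close> and \<open>R + Rl = iY - 2 * \<delta>\<close>;
    \<open>\<eta>\<close> is the slack of \<open>R\<close> above \<open>iZ - iS\<close>.\<close>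
  define \<delta> where "\<delta> = (iY - iS - R) / 4"
  define \<eta> where "\<eta> = R + iS - iZ"
  define Rl where "Rl = iS + 2 * \<delta>"
  have pos: "\<delta> > 0" "\<eta> > 0" "Rl \<ge> 0" using R iS_nonneg by (auto simp: \<delta>_def \<eta>_def Rl_def)

  let ?JZ = "joint3 PT kS wZ" and ?JY = "joint3 PT kS wY"
  note posZ = joint_pos[where w = wZ] joint_pos_Z
  have "\<exists>\<rho>. 0 \<le> \<rho> \<and> \<rho> < 1 \<and> (\<forall>n c. c \<ge> 2 powr (real n * (iS + \<delta>)) \<longrightarrow>
    measure_pmf.prob (iid_pmf n ?JZ) {l. prod_list (map (\<lambda>(t,s,z). pmf (kS t) s) l)
      \<ge> c * prod_list (map (\<lambda>(t,s,z). pmf QS s) l)} \<le> \<rho> ^ n)"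
    by (rule likelihood_ratio_tail[OF fin_joint])
       (use pos in \<open>auto simp: iS_def case_prod_unfold posZ split_paired_all\<close>)
  then obtain \<rho>1 where \<rho>1: "0 \<le> \<rho>1" "\<rho>1 < 1" "\<And>n c. c \<ge> 2 powr (real n * (iS + \<delta>)) \<Longrightarrow>
    measure_pmf.prob (iid_pmf n ?JZ) {l. prod_list (map (\<lambda>(t,s,z). pmf (kS t) s) l)
      \<ge> c * prod_list (map (\<lambda>(t,s,z). pmf QS s) l)} \<le> \<rho>1 ^ n" by blast
  have "\<exists>\<rho>. 0 \<le> \<rho> \<and> \<rho> < 1 \<and> (\<forall>n c. c \<ge> 2 powr (real n * (iZ + \<eta> / 2)) \<longrightarrow>
    measure_pmf.prob (iid_pmf n ?JZ) {l. prod_list (map (\<lambda>(t,s,z). pmf (kZ t) z) l)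
      \<ge> c * prod_list (map (\<lambda>(t,s,z). pmf QZ z) l)} \<le> \<rho> ^ n)"
    by (rule likelihood_ratio_tail[OF fin_joint])
       (use pos in \<open>auto simp: iZ_def case_prod_unfold posZ split_paired_all\<close>)
  then obtain \<rho>2 where \<rho>2: "0 \<le> \<rho>2" "\<rho>2 < 1" "\<And>n c. c \<ge> 2 powr (real n * (iZ + \<eta> / 2)) \<Longrightarrow>
    measure_pmf.prob (iid_pmf n ?JZ) {l. prod_list (map (\<lambda>(t,s,z). pmf (kZ t) z) l)
      \<ge> c * prod_list (map (\<lambda>(t,s,z). pmf QZ z) l)} \<le> \<rho>2 ^ n" by blast
  \<comment> \<open>The ratio is inverted because a missed detection is a lower tail of the
    information density.\<close>
  have meanY: "expct ?JY (\<lambda>x. log 2 ((\<lambda>(t,s,y). pmf QY y) x / (\<lambda>(t,s,y). pmf (kY t) y) x)) = - iY"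
    unfolding iY_def integral_minus[symmetric]
    by (intro expct_cong) (auto simp: joint_pos_Y log_divide)
  have "\<exists>\<rho>. 0 \<le> \<rho> \<and> \<rho> < 1 \<and> (\<forall>n c. c \<ge> 2 powr (real n * (- (iY - \<delta>))) \<longrightarrow>
    measure_pmf.prob (iid_pmf n ?JY) {l. prod_list (map (\<lambda>(t,s,y). pmf QY y) l)
      \<ge> c * prod_list (map (\<lambda>(t,s,y). pmf (kY t) y) l)} \<le> \<rho> ^ n)"
    by (rule likelihood_ratio_tail[OF fin_joint]; (unfold meanY)?)
       (use pos in \<open>auto simp: case_prod_unfold joint_pos_Y split_paired_all\<close>)
  then obtain \<rho>3 where \<rho>3: "0 \<le> \<rho>3" "\<rho>3 < 1" "\<And>n c. c \<ge> 2 powr (real n * (- (iY - \<delta>))) \<Longrightarrow>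
    measure_pmf.prob (iid_pmf n ?JY) {l. prod_list (map (\<lambda>(t,s,y). pmf QY y) l)
      \<ge> c * prod_list (map (\<lambda>(t,s,y). pmf (kY t) y) l)} \<le> \<rho>3 ^ n" by blast
  \<comment> \<open>Since \<open>k(s|t) w(z|t,s) \<le> k_Z(z|t)\<close>, the event \<open>Q_S(s) w(z|t,s) > c Q_Z(z)\<close> is contained in
    \<open>Q_S(s) k_Z(z|t) \<ge> c Q_Z(z) k(s|t)\<close>, whose log-likelihood ratio has mean \<open>iZ - iS\<close>.\<close>
  have meanSZ: "expct ?JZ (\<lambda>x. log 2 ((\<lambda>(t,s,z). pmf QS s * pmf (kZ t) z) x / (\<lambda>(t,s,z). pmf QZ z * pmf (kS t) s) x))
      = iZ - iS"
    unfolding iZ_def iS_def expct_diff[OF fin_joint, symmetric]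
  proof (rule expct_cong)
    fix x assume x: "x \<in> set_pmf ?JZ"
    obtain t s z where [simp]: "x = (t, s, z)" by (cases x) auto
    note pos = posZ[OF x[simplified]]
    show "log 2 ((\<lambda>(t,s,z). pmf QS s * pmf (kZ t) z) x / (\<lambda>(t,s,z). pmf QZ z * pmf (kS t) s) x)
      = (case x of (t, s, z) \<Rightarrow> log 2 (pmf (kZ t) z / pmf QZ z)) - (case x of (t, s, z) \<Rightarrow> log 2 (pmf (kS t) s / pmf QS s))"
      using pos(1,2,5,6) by (simp add: log_divide log_mult)
  qed
  have "\<exists>\<rho>. 0 \<le> \<rho> \<and> \<rho> < 1 \<and> (\<forall>n c. c \<ge> 2 powr (real n * (iZ - iS + \<eta> / 2)) \<longrightarrow>
    measure_pmf.prob (iid_pmf n ?JZ) {l. prod_list (map (\<lambda>(t,s,z). pmf QS s * pmf (kZ t) z) l)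
      \<ge> c * prod_list (map (\<lambda>(t,s,z). pmf QZ z * pmf (kS t) s) l)} \<le> \<rho> ^ n)"
    by (rule likelihood_ratio_tail[OF fin_joint]; (unfold meanSZ)?)
       (use pos in \<open>auto simp: case_prod_unfold posZ split_paired_all\<close>)
  then obtain \<rho>4 where \<rho>4: "0 \<le> \<rho>4" "\<rho>4 < 1" "\<And>n c. c \<ge> 2 powr (real n * (iZ - iS + \<eta> / 2)) \<Longrightarrow>
    measure_pmf.prob (iid_pmf n ?JZ) {l. prod_list (map (\<lambda>(t,s,z). pmf QS s * pmf (kZ t) z) l)
      \<ge> c * prod_list (map (\<lambda>(t,s,z). pmf QZ z * pmf (kS t) s) l)} \<le> \<rho>4 ^ n" by blast

  \<comment> \<open>The two powers of 2 are the n-th roots of \<open>sqrt \<alpha>\<close> and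
    \<open>sqrt \<beta>\<close> for the thresholds chosen below.\<close>
  define \<rho> where "\<rho> = Max {\<rho>1, \<rho>2, \<rho>3, \<rho>4, 2 powr (- \<delta> / 2), 2 powr (- \<eta> / 4)}"
  have powr_less: "2 powr (- x) < 1" if "x > 0" for x :: real
    using that powr_less_mono[of "- x" 0 "2::real"] by simp
  have \<rho>: "0 \<le> \<rho>" "\<rho> < 1" "\<rho>1 \<le> \<rho>" "\<rho>2 \<le> \<rho>" "\<rho>3 \<le> \<rho>" "\<rho>4 \<le> \<rho>"
    "2 powr (- \<delta> / 2) \<le> \<rho>" "2 powr (- \<eta> / 4) \<le> \<rho>"
    using \<rho>1 \<rho>2 \<rho>3 \<rho>4 pos powr_less[of "\<delta> / 2"] powr_less[of "\<eta> / 4"] by (auto simp: \<rho>_def)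
  have npow: "2 powr (real n * x) = (2 powr x) ^ n" for n x
    by (simp add: powr_realpow[symmetric] powr_powr mult.commute)

  have "\<exists>f dc. (\<forall>m s. length (f m s) = n) \<and>
    (\<Sum>(m,s)\<in>{..<num_msgs n R} \<times> {s. length s = n}. pmf (iid_pmf n QS) s / real (num_msgs n R)
        * measure_pmf.prob (seq_pmf wY (zip (f m s) s)) {y. dc y \<noteq> m})
    + (\<Sum>z\<in>{z. length z = n}. \<bar>(\<Sum>(m,s)\<in>{..<num_msgs n R} \<times> {s. length s = n}.
          pmf (iid_pmf n QS) s / real (num_msgs n R) * pmf (seq_pmf wZ (zip (f m s) s)) z) - pmf (iid_pmf n QZ) z\<bar>)
    \<le> 23 * \<rho> ^ n" for n
  proof -
    let ?K = "num_msgs n R" and ?L = "num_msgs n Rl"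
    interpret B: state_code "iid_pmf n PT" "seq_pmf kS" "\<lambda>ts ss. seq_pmf wY (zip ts ss)"
      "\<lambda>ts ss. seq_pmf wZ (zip ts ss)" "{ss. length ss = n}" "{zs. length zs = n}" ?K ?L
    proof
      show "finite (set_pmf (iid_pmf n PT))" using fin_T by (rule finite_set_iid_pmf)
      show "set_pmf (seq_pmf kS t) \<subseteq> {ss. length ss = n}" if "t \<in> set_pmf (iid_pmf n PT)" for t
        using that by (auto simp: set_iid_pmf dest: length_seq_pmf)
      show "set_pmf (seq_pmf wZ (zip t s)) \<subseteq> {zs. length zs = n}"
        if "t \<in> set_pmf (iid_pmf n PT)" "s \<in> {ss. length ss = n}" for t s
        using that by (auto simp: set_iid_pmf dest: length_seq_pmf)
    qed (auto simp: num_msgs_pos finite_lists_length_eq finite_set_seq_pmf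
          finite_lists_length_eq[of UNIV, simplified])
    have PS: "B.PS = iid_pmf n QS" by (simp add: B.PS_def QS_def bind_iid_seq)
    have ky: "B.ky ts = seq_pmf kY ts" for ts by (simp add: B.ky_def bind_seq_seq kY_def[abs_def])
    have kz: "B.kz ts = seq_pmf kZ ts" for ts by (simp add: B.kz_def bind_seq_seq kZ_def[abs_def])
    have PY: "B.PY = iid_pmf n QY" unfolding B.PY_def ky[abs_def] by (simp add: bind_iid_seq QY_def)
    have PZ: "B.PZ = iid_pmf n QZ" unfolding B.PZ_def kz[abs_def] by (simp add: bind_iid_seq QZ_def)
    have fin_seq: "finite (set_pmf (seq_pmf k ts))" for k :: "_ \<Rightarrow> 'a::finite pmf" and ts
      by (rule finite_set_seq_pmf) simp
    have fin_iid: "finite (set_pmf (iid_pmf n (joint3 PT kS w)))" for w :: "_ \<Rightarrow> 'a::finite pmf"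
      by (rule finite_set_iid_pmf[OF fin_joint])

    \<comment> \<open>\<open>\<alpha>\<close> and \<open>\<beta>\<close> decay so slowly that
      \<open>L * \<alpha>\<close>, \<open>K * L * \<beta>\<close> and \<open>K * \<beta>\<close>
      stay exponentially above the means \<open>iS\<close>, \<open>iZ\<close> and
      \<open>iZ - iS\<close>, while the exponent of \<open>\<gamma>\<close> lies between
      \<open>R + Rl\<close> and \<open>iY\<close>. The value \<open>\<beta>\<close> is also used for
      \<open>\<theta>\<close>.\<close>
    define \<alpha> where "\<alpha> = 2 powr (real n * (- \<delta>))"
    define \<beta> where "\<beta> = 2 powr (real n * (- \<eta> / 2))"
    define \<gamma> where "\<gamma> = 2 powr (real n * (iY - \<delta>))"
    have K: "2 powr (real n * R) \<le> real ?K" "real ?K \<le> 2 * 2 powr (real n * R)"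
      using R by (auto intro: num_msgs_ge num_msgs_le)
    have L: "2 powr (real n * Rl) \<le> real ?L" "real ?L \<le> 2 * 2 powr (real n * Rl)"
      using pos by (auto intro: num_msgs_ge num_msgs_le)

    have c1: "2 powr (real n * (iS + \<delta>)) \<le> real ?L * \<alpha>"
    proof -
      have "2 powr (real n * (iS + \<delta>)) = 2 powr (real n * Rl) * \<alpha>"
        by (simp add: \<alpha>_def Rl_def powr_add[symmetric] algebra_simps)
      thus ?thesis using L(1) by (simp add: \<alpha>_def mult_right_mono)
    qed
    have c2: "2 powr (real n * (iZ + \<eta> / 2)) \<le> real ?K * real ?L * \<beta>"
    proof -
      have "2 powr (real n * (iZ + \<eta> / 2)) \<le> 2 powr (real n * (iZ + \<eta> / 2 + 2 * \<delta>))"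
        using pos by (intro powr_mono mult_left_mono) auto
      also have "\<dots> = 2 powr (real n * R) * 2 powr (real n * Rl) * \<beta>"
        unfolding \<beta>_def Rl_def \<eta>_def powr_add[symmetric]
        by (rule arg_cong[where f = "\<lambda>x. 2 powr x"]) (simp add: field_simps)
      also have "\<dots> \<le> real ?K * real ?L * \<beta>"
        using K(1) L(1) by (intro mult_right_mono mult_mono) (auto simp: \<beta>_def)
      finally show ?thesis .
    qed
    have c4: "2 powr (real n * (iZ - iS + \<eta> / 2)) \<le> real ?K * \<beta>"
    proof -
      have "2 powr (real n * (iZ - iS + \<eta> / 2)) = 2 powr (real n * R) * \<beta>"
        unfolding \<beta>_def \<eta>_def powr_add[symmetric]
        by (rule arg_cong[where f = "\<lambda>x. 2 powr x"]) (simp add: field_simps)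
      thus ?thesis using K(1) by (simp add: \<beta>_def mult_right_mono)
    qed

    have "B.cover_S \<alpha> = measure_pmf.prob (iid_pmf n ?JZ) {l. pmf (seq_pmf kS (map fst l)) (map (fst \<circ> snd) l)
        > real ?L * \<alpha> * pmf (iid_pmf n QS) (map (fst \<circ> snd) l)}"
      unfolding B.cover_S_def PS prob_iid_joint3[OF fin_T, symmetric, of _ _ _ "\<lambda>ts ss zs. pmf (seq_pmf kS ts) ss > real ?L * \<alpha> * pmf (iid_pmf n QS) ss"]
      by (intro expct_cong) (subst prob_eq_expct, auto intro!: expct_cong)
    also have "\<dots> \<le> measure_pmf.prob (iid_pmf n ?JZ) {l. prod_list (map (\<lambda>(t,s,z). pmf (kS t) s) l)
      \<ge> real ?L * \<alpha> * prod_list (map (\<lambda>(t,s,z). pmf QS s) l)}"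
      by (rule prob_mono_support[OF fin_iid])
         (auto simp: set_iid_pmf pmf_seq_map pmf_iid_map case_prod_unfold)
    also have "\<dots> \<le> \<rho>1 ^ n" by (rule \<rho>1(3)[OF c1])
    finally have t1: "B.cover_S \<alpha> \<le> \<rho> ^ n"
      using power_mono[OF \<rho>(3) \<rho>1(1), of n] by linarith

    have "B.cover_Z \<beta> = measure_pmf.prob (iid_pmf n ?JZ) {l. pmf (seq_pmf kZ (map fst l)) (map (snd \<circ> snd) l)
        > real ?K * real ?L * \<beta> * pmf (iid_pmf n QZ) (map (snd \<circ> snd) l)}"
      unfolding B.cover_Z_def PZ kz prob_iid_joint3[OF fin_T, symmetric, of _ _ _ "\<lambda>ts ss zs. pmf (seq_pmf kZ ts) zs > real ?K * real ?L * \<beta> * pmf (iid_pmf n QZ) zs"]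
      unfolding kZ_def[abs_def] bind_seq_seq[symmetric] by (subst prob_bind) (auto intro: fin_seq)
    also have "\<dots> \<le> measure_pmf.prob (iid_pmf n ?JZ) {l. prod_list (map (\<lambda>(t,s,z). pmf (kZ t) z) l)
      \<ge> real ?K * real ?L * \<beta> * prod_list (map (\<lambda>(t,s,z). pmf QZ z) l)}"
      by (rule prob_mono_support[OF fin_iid])
         (auto simp: set_iid_pmf pmf_seq_map pmf_iid_map case_prod_unfold)
    also have "\<dots> \<le> \<rho>2 ^ n" by (rule \<rho>2(3)[OF c2])
    finally have t2: "B.cover_Z \<beta> \<le> \<rho> ^ n"
      using power_mono[OF \<rho>(4) \<rho>2(1), of n] by linarith

    have "B.pack_Y \<gamma> = measure_pmf.prob (iid_pmf n ?JY) {l. pmf (seq_pmf kY (map fst l)) (map (snd \<circ> snd) l)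
        \<le> \<gamma> * pmf (iid_pmf n QY) (map (snd \<circ> snd) l)}"
      unfolding B.pack_Y_def PY ky prob_iid_joint3[OF fin_T, symmetric, of _ _ _ "\<lambda>ts ss ys. pmf (seq_pmf kY ts) ys \<le> \<gamma> * pmf (iid_pmf n QY) ys"]
      unfolding kY_def[abs_def] bind_seq_seq[symmetric] by (subst prob_bind) (auto intro: fin_seq)
    also have "\<dots> \<le> measure_pmf.prob (iid_pmf n ?JY) {l. prod_list (map (\<lambda>(t,s,y). pmf QY y) l)
      \<ge> 2 powr (real n * (- (iY - \<delta>))) * prod_list (map (\<lambda>(t,s,y). pmf (kY t) y) l)}"
    proof (rule prob_mono_support[OF fin_iid])
      have \<gamma>: "2 powr (real n * (- (iY - \<delta>))) = inverse \<gamma>" "\<gamma> > 0"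
        by (simp_all only: \<gamma>_def powr_minus[symmetric] mult_minus_right) simp
      fix l assume "l \<in> set_pmf (iid_pmf n ?JY)" "l \<in> {l. pmf (seq_pmf kY (map fst l)) (map (snd \<circ> snd) l)
        \<le> \<gamma> * pmf (iid_pmf n QY) (map (snd \<circ> snd) l)}"
      thus "l \<in> {l. prod_list (map (\<lambda>(t,s,y). pmf QY y) l)
        \<ge> 2 powr (real n * (- (iY - \<delta>))) * prod_list (map (\<lambda>(t,s,y). pmf (kY t) y) l)}"
        unfolding \<gamma>(1) using \<gamma>(2)
        by (auto simp: set_iid_pmf pmf_seq_map pmf_iid_map case_prod_unfold field_simps)
    qed
    also have "\<dots> \<le> \<rho>3 ^ n" by (rule \<rho>3(3)[OF order_refl])
    finally have t3: "B.pack_Y \<gamma> \<le> \<rho> ^ n"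
      using power_mono[OF \<rho>(5) \<rho>3(1), of n] by linarith

    have "B.cover_SZ \<beta> = measure_pmf.prob (iid_pmf n ?JZ) {l.
        pmf (iid_pmf n QS) (map (fst \<circ> snd) l) * pmf (seq_pmf wZ (zip (map fst l) (map (fst \<circ> snd) l))) (map (snd \<circ> snd) l)
        > real ?K * \<beta> * pmf (iid_pmf n QZ) (map (snd \<circ> snd) l)}"
      unfolding B.cover_SZ_def B.atyp_def PZ PS by (subst prob_iid_joint3[OF fin_T]) simp
    also have "\<dots> \<le> measure_pmf.prob (iid_pmf n ?JZ) {l. prod_list (map (\<lambda>(t,s,z). pmf QS s * pmf (kZ t) z) l)
      \<ge> real ?K * \<beta> * prod_list (map (\<lambda>(t,s,z). pmf QZ z * pmf (kS t) s) l)}"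
    proof (rule prob_mono_support[OF fin_iid])
      have split: "prod_list (map (\<lambda>(t,s,z). a t s z * b t s z) l)
          = prod_list (map (\<lambda>(t,s,z). a t s z) l) * (prod_list (map (\<lambda>(t,s,z). b t s z) l) :: real)" for a b and l :: "('t \<times> 's \<times> 'z) list"
        by (induction l) (auto simp: mult_ac)
      fix l assume l: "l \<in> set_pmf (iid_pmf n ?JZ)" and "l \<in> {l.
        pmf (iid_pmf n QS) (map (fst \<circ> snd) l) * pmf (seq_pmf wZ (zip (map fst l) (map (fst \<circ> snd) l))) (map (snd \<circ> snd) l)
        > real ?K * \<beta> * pmf (iid_pmf n QZ) (map (snd \<circ> snd) l)}"
      hence gt: "pmf (iid_pmf n QS) (map (fst \<circ> snd) l) * pmf (seq_pmf wZ (zip (map fst l) (map (fst \<circ> snd) l))) (map (snd \<circ> snd) l)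
        > real ?K * \<beta> * pmf (iid_pmf n QZ) (map (snd \<circ> snd) l)" (is "?q * ?w > ?c * ?z") by simp
      let ?k = "pmf (seq_pmf kS (map fst l)) (map (fst \<circ> snd) l)"
      let ?kz = "pmf (seq_pmf kZ (map fst l)) (map (snd \<circ> snd) l)"
      have "?k * ?w \<le> ?kz"
        unfolding kZ_def[abs_def] bind_seq_seq[symmetric] by (rule pmf_bind_ge[OF fin_seq])
      hence "?q * (?k * ?w) \<le> ?q * ?kz" by (intro mult_left_mono) auto
      moreover have "?c * ?z * ?k \<le> ?q * ?w * ?k" using gt by (intro mult_right_mono) auto
      ultimately have "?q * ?kz \<ge> ?c * (?z * ?k)" by (simp add: mult_ac)
      thus "l \<in> {l. prod_list (map (\<lambda>(t,s,z). pmf QS s * pmf (kZ t) z) l)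
        \<ge> real ?K * \<beta> * prod_list (map (\<lambda>(t,s,z). pmf QZ z * pmf (kS t) s) l)}"
        unfolding split using l
        by (auto simp: set_iid_pmf pmf_seq_map pmf_iid_map case_prod_unfold)
    qed
    also have "\<dots> \<le> \<rho>4 ^ n" by (rule \<rho>4(3)[OF c4])
    finally have t4: "B.cover_SZ \<beta> \<le> \<rho> ^ n"
      using power_mono[OF \<rho>(6) \<rho>4(1), of n] by linarith

    have sq: "sqrt (2 powr (real n * x)) = (2 powr (x / 2)) ^ n" for x
      unfolding npow[symmetric] by (simp add: powr_half_sqrt[symmetric] powr_powr mult.commute)
    have t5: "sqrt \<alpha> \<le> \<rho> ^ n" "sqrt \<beta> \<le> \<rho> ^ n"
      unfolding \<alpha>_def \<beta>_def sq using \<rho>(7,8) by (auto intro!: power_mono)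
    have "real ?K * real ?L / \<gamma> \<le> (2 * 2 powr (real n * R)) * (2 * 2 powr (real n * Rl)) / \<gamma>"
      using K(2) L(2) by (intro divide_right_mono mult_mono) (auto simp: \<gamma>_def)
    also have "\<dots> = 4 * (2 powr (real n * R) * 2 powr (real n * Rl) * 2 powr (- (real n * (iY - \<delta>))))"
      by (simp add: \<gamma>_def powr_minus divide_inverse)
    also have "\<dots> = 4 * 2 powr (real n * (- \<delta>))"
      unfolding powr_add[symmetric] \<delta>_def Rl_def
      by (rule arg_cong[where f = "\<lambda>x. 4 * 2 powr x"]) (simp add: field_simps)
    \<comment> \<open>Half of the exponent gives \<open>\<rho> ^ n\<close>, the other half is
      bounded by 1.\<close>
    also have "\<dots> = 4 * (2 powr (real n * (- \<delta> / 2)) * 2 powr (real n * (- \<delta> / 2)))"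
      unfolding powr_add[symmetric]
      by (rule arg_cong[where f = "\<lambda>x. 4 * 2 powr x"]) (simp add: field_simps)
    also have "\<dots> \<le> 4 * (\<rho> ^ n * 1)"
      unfolding npow using \<rho>(1,7) pos
      by (intro mult_left_mono mult_mono power_mono power_le_one) (auto intro: less_imp_le powr_less[of "\<delta> / 2", simplified])
    finally have t6: "real ?K * real ?L / \<gamma> \<le> 4 * \<rho> ^ n" by simp

    have nn: "\<alpha> \<ge> 0" "\<beta> \<ge> 0" "\<gamma> > 0" by (simp_all add: \<alpha>_def \<beta>_def \<gamma>_def)
    obtain f dc where f: "\<forall>m s. f m s \<in> set_pmf (iid_pmf n PT)" and
      le: "(\<Sum>(m,s)\<in>B.J. pmf B.PS s / real ?K * measure_pmf.prob (seq_pmf wY (zip (f m s) s)) {y. dc y \<noteq> m})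
     + (\<Sum>z\<in>{z. length z = n}. \<bar>(\<Sum>(m,s)\<in>B.J. pmf B.PS s / real ?K * pmf (seq_pmf wZ (zip (f m s) s)) z) - pmf B.PZ z\<bar>)
     \<le> 4 * (2 * B.cover_S \<alpha> + sqrt \<alpha>) + (2 * B.cover_Z \<beta> + sqrt \<beta>)
       + (B.pack_Y \<gamma> + real ?K * real ?L / \<gamma>) + 2 * B.cover_SZ \<beta> + sqrt \<beta>"
      using B.one_shot[OF nn(1,2,3,2)] by blast
    note le
    \<comment> \<open>The coefficients on the right add up to 12 + 3 + 5 + 2 + 1 = 23.\<close>
    also have "4 * (2 * B.cover_S \<alpha> + sqrt \<alpha>) + (2 * B.cover_Z \<beta> + sqrt \<beta>)
       + (B.pack_Y \<gamma> + real ?K * real ?L / \<gamma>) + 2 * B.cover_SZ \<beta> + sqrt \<beta>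
      \<le> 4 * (2 * \<rho> ^ n + \<rho> ^ n) + (2 * \<rho> ^ n + \<rho> ^ n) + (\<rho> ^ n + 4 * \<rho> ^ n) + 2 * \<rho> ^ n + \<rho> ^ n"
      by (intro add_mono mult_left_mono t1 t2 t3 t4 t5 t6) auto
    finally show ?thesis
      using f by (intro exI[of _ f] exI[of _ dc]) (auto simp: B.J_def PS PZ set_iid_pmf)
  qed
  thus ?thesis using \<rho> by blast
qed

end

section \<open>Relative entropy and mutual information\<close>

text \<open>Both bounds rest on \<open>ln x \<le> x - 1\<close>. In the upper one, only points with
  \<open>pmf P a \<ge> pmf Q a\<close> can contribute positively, and there the log-ratio is at most
  \<open>ln (1 / \<mu>)\<close>. For an n-fold product with least mass \<open>\<mu> ^ n\<close> the
  factor is thus linear in n.\<close>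

lemma KL_div_bounds:
  assumes fin: "finite (set_pmf Q)" and sub: "set_pmf P \<subseteq> set_pmf Q"
    and \<mu>: "\<mu> > 0" "\<And>a. a \<in> set_pmf Q \<Longrightarrow> pmf Q a \<ge> \<mu>"
  shows "\<exists>x. KL_div P Q = ereal x \<and> 0 \<le> x \<and> x \<le> (1 + ln (1 / \<mu>)) * (\<Sum>a\<in>set_pmf Q. \<bar>pmf P a - pmf Q a\<bar>)"
proof -
  define x where "x = (\<Sum>a\<in>set_pmf P. pmf P a * ln (pmf P a / pmf Q a))"
  have finP: "finite (set_pmf P)" using fin sub finite_subset by blast
  have pos: "pmf P a > 0" "pmf Q a > 0" if "a \<in> set_pmf P" for a
    using that sub by (auto simp: pmf_positive_iff)
  obtain a0 where "a0 \<in> set_pmf Q" using set_pmf_not_empty[of Q] by blast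
  hence "\<mu> \<le> 1" using \<mu>(2) pmf_le_1[of Q a0] by fastforce
  hence c: "ln (1 / \<mu>) \<ge> 0" using \<mu>(1) by simp
  have "0 \<le> 1 - measure_pmf.prob Q (set_pmf P)" by simp
  also have "\<dots> = (\<Sum>a\<in>set_pmf P. pmf P a - pmf Q a)"
    using finP by (simp add: sum_subtractf sum_pmf_eq_1 measure_measure_pmf_finite)
  also have "\<dots> \<le> x" unfolding x_def
  proof (rule sum_mono)
    fix a assume a: "a \<in> set_pmf P"
    have "ln (pmf Q a / pmf P a) \<le> pmf Q a / pmf P a - 1"
      using pos[OF a] by (intro ln_le_minus_one) auto
    hence "pmf P a * (1 - pmf Q a / pmf P a) \<le> pmf P a * ln (pmf P a / pmf Q a)"
      using pos[OF a] by (intro mult_left_mono) (auto simp: ln_div)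
    thus "pmf P a - pmf Q a \<le> pmf P a * ln (pmf P a / pmf Q a)"
      using pos[OF a] by (simp add: right_diff_distrib)
  qed
  finally have x0: "0 \<le> x" .
  have "x \<le> (\<Sum>a\<in>set_pmf P. (1 + ln (1 / \<mu>)) * \<bar>pmf P a - pmf Q a\<bar>)"
    unfolding x_def
  proof (rule sum_mono)
    fix a assume a: "a \<in> set_pmf P"
    show "pmf P a * ln (pmf P a / pmf Q a) \<le> (1 + ln (1 / \<mu>)) * \<bar>pmf P a - pmf Q a\<bar>"
    proof (cases "pmf P a \<ge> pmf Q a")
      case True
      have "pmf P a / pmf Q a \<le> 1 / \<mu>"
        using \<mu>(1) \<mu>(2)[of a] a sub pos[OF a] pmf_le_1[of P a] by (intro frac_le) auto
      hence "ln (pmf P a / pmf Q a) \<le> ln (1 / \<mu>)" using pos[OF a] \<mu>(1) by simp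
      hence "(pmf P a - pmf Q a) * ln (pmf P a / pmf Q a) \<le> (pmf P a - pmf Q a) * ln (1 / \<mu>)"
        using True by (intro mult_left_mono) auto
      moreover have "pmf Q a * ln (pmf P a / pmf Q a) \<le> pmf Q a * (pmf P a / pmf Q a - 1)"
        using pos[OF a] by (intro mult_left_mono ln_le_minus_one) auto
      moreover have "pmf Q a * (pmf P a / pmf Q a - 1) = pmf P a - pmf Q a"
        using pos[OF a] by (simp add: field_simps)
      ultimately show ?thesis using True by (simp add: algebra_simps)
    next
      case False
      hence "ln (pmf P a / pmf Q a) \<le> 0" using pos[OF a] by simp
      hence "pmf P a * ln (pmf P a / pmf Q a) \<le> 0" by (simp add: mult_nonneg_nonpos)
      also have "0 \<le> (1 + ln (1 / \<mu>)) * \<bar>pmf P a - pmf Q a\<bar>" using c by simp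
      finally show ?thesis .
    qed
  qed
  also have "\<dots> \<le> (\<Sum>a\<in>set_pmf Q. (1 + ln (1 / \<mu>)) * \<bar>pmf P a - pmf Q a\<bar>)"
    using fin sub c by (intro sum_mono2) auto
  finally have "x \<le> (1 + ln (1 / \<mu>)) * (\<Sum>a\<in>set_pmf Q. \<bar>pmf P a - pmf Q a\<bar>)"
    by (simp add: sum_distrib_left)
  thus ?thesis using x0 sub by (intro exI[of _ x]) (auto simp: KL_div_def x_def)
qed

lemma pmf_iid_ge:
  assumes "\<And>z. pmf q z \<ge> \<mu>" "\<mu> \<ge> 0"
  shows "pmf (iid_pmf (length zs) q) zs \<ge> \<mu> ^ length zs"
proof (induction zs)
  case (Cons z zs)
  thus ?case using assms by (simp add: pmf_bind_map_Cons mult_mono)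
qed simp

section \<open>From the channel code to product kernels\<close>

lemma seq_pmf_map: "seq_pmf k (map h as) = seq_pmf (\<lambda>a. k (h a)) as"
  by (induction as) simp_all

text \<open>Decoding error and covertness each involve one output only, so the coupling of the two
  outputs may be forgotten. \<open>zip\<close> truncates exactly where \<open>chan_seq\<close>
  stops, hence no condition on lengths.\<close>

lemma map_fst_chan_seq: "map_pmf fst (chan_seq W xs ss) = seq_pmf (\<lambda>(x, s). map_pmf fst (W x s)) (zip xs ss)"
proof (induction xs arbitrary: ss)
  case (Cons x xs)
  show ?case
  proof (cases ss)
    case (Cons s ss')
    have "map_pmf fst (chan_seq W (x # xs) (s # ss'))
        = bind_pmf (W x s) (\<lambda>yz. map_pmf (\<lambda>ys. fst yz # ys) (map_pmf fst (chan_seq W xs ss')))"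
      by (simp add: map_bind_pmf pmf.map_comp o_def case_prod_unfold)
    thus ?thesis unfolding Cons.IH by (simp add: Cons bind_map_pmf)
  qed simp
qed simp

lemma map_snd_chan_seq: "map_pmf snd (chan_seq W xs ss) = seq_pmf (\<lambda>(x, s). map_pmf snd (W x s)) (zip xs ss)"
proof (induction xs arbitrary: ss)
  case (Cons x xs)
  show ?case
  proof (cases ss)
    case (Cons s ss')
    have "map_pmf snd (chan_seq W (x # xs) (s # ss'))
        = bind_pmf (W x s) (\<lambda>yz. map_pmf (\<lambda>zs. snd yz # zs) (map_pmf snd (chan_seq W xs ss')))"
      by (simp add: map_bind_pmf pmf.map_comp o_def case_prod_unfold)
    thus ?thesis unfolding Cons.IH by (simp add: Cons bind_map_pmf)
  qed simp
qed simp

lemma finite_length_eq: "finite {xs :: 'a::finite list. length xs = n}"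
  using finite_lists_length_eq[of "UNIV :: 'a set" n] by simp

lemma expct_message_state:
  fixes QS :: "'s::finite pmf"
  assumes "K > 0"
  shows "expct (pmf_of_set {..<K}) (\<lambda>m. expct (iid_pmf n QS) (h m))
    = (\<Sum>(m, s)\<in>{..<K} \<times> {s. length s = n}. pmf (iid_pmf n QS) s / real K * h m s)"
proof -
  have "expct (iid_pmf n QS) (h m) = (\<Sum>s\<in>{s. length s = n}. pmf (iid_pmf n QS) s * h m s)" for m
    by (intro expct_eq_sum finite_length_eq) (auto simp: set_iid_pmf)
  thus ?thesis
    using assms by (simp add: integral_pmf_of_set lessThan_empty_iff sum.cartesian_product[symmetric]
        sum_divide_distrib)
qed

lemma finite_chan_seq: "finite (set_pmf (chan_seq (W :: 'x \<Rightarrow> 's \<Rightarrow> ('y::finite \<times> 'z::finite) pmf) xs ss))"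
  by (induction W xs ss rule: chan_seq.induct) (auto simp: case_prod_unfold)

lemma nct_error_prob_eq:
  fixes QS :: "'s::finite pmf" and W :: "'x \<Rightarrow> 's \<Rightarrow> ('y::finite \<times> 'z::finite) pmf"
  assumes "K > 0"
  shows "nct_error_prob n K QS W enc dec = (\<Sum>(m, s)\<in>{..<K} \<times> {s. length s = n}.
     pmf (iid_pmf n QS) s / real K *
     measure_pmf.prob (seq_pmf (\<lambda>(x, s). map_pmf fst (W x s)) (zip (enc m s) s)) {y. dec y \<noteq> m})"
proof -
  have fin: "finite (set_pmf (pmf_of_set {..<K}))" "finite (set_pmf (iid_pmf n QS))"
    using assms by (auto simp: lessThan_empty_iff intro: finite_set_iid_pmf)
  have "nct_error_prob n K QS W enc dec = expct (pmf_of_set {..<K}) (\<lambda>m. expct (iid_pmf n QS)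
     (\<lambda>s. measure_pmf.prob (map_pmf (\<lambda>(y, z). (m, y, z)) (chan_seq W (enc m s) s)) {(m, y, z). dec y \<noteq> m}))"
    unfolding nct_error_prob_def nct_code_dist_def
    using fin finite_chan_seq[of W] by (simp add: prob_bind)
  also have "\<dots> = expct (pmf_of_set {..<K}) (\<lambda>m. expct (iid_pmf n QS)
     (\<lambda>s. measure_pmf.prob (map_pmf fst (chan_seq W (enc m s) s)) {y. dec y \<noteq> m}))"
    by (simp add: vimage_def case_prod_unfold)
  finally show ?thesis unfolding map_fst_chan_seq expct_message_state[OF assms] .
qed

lemma nct_warden_dist_eq:
  "nct_warden_dist n K QS W enc = bind_pmf (pmf_of_set {..<K}) (\<lambda>m. bind_pmf (iid_pmf n QS)
     (\<lambda>s. seq_pmf (\<lambda>(x, s). map_pmf snd (W x s)) (zip (enc m s) s)))"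
  unfolding nct_warden_dist_def nct_code_dist_def map_snd_chan_seq[symmetric]
  by (simp add: map_bind_pmf pmf.map_comp o_def case_prod_unfold)

lemma pmf_nct_warden_dist:
  fixes QS :: "'s::finite pmf"
  assumes "K > 0"
  shows "pmf (nct_warden_dist n K QS W enc) z = (\<Sum>(m, s)\<in>{..<K} \<times> {s. length s = n}.
     pmf (iid_pmf n QS) s / real K * pmf (seq_pmf (\<lambda>(x, s). map_pmf snd (W x s)) (zip (enc m s) s)) z)"
  unfolding nct_warden_dist_eq pmf_bind by (rule expct_message_state[OF assms])

text \<open>With a single message, always sending \<open>x0\<close> reproduces the innocent law
  exactly. This settles rate 0, while the random coding assumes \<open>0 < R\<close>.\<close>

lemma covert_achievable_zero:
  fixes QS :: "'s::finite pmf" and W :: "'x \<Rightarrow> 's \<Rightarrow> ('y::finite \<times> 'z::finite) pmf"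
  shows "covert_achievable_NCT QS W x0 0"
proof -
  have K: "num_msgs n 0 = 1" for n by (simp add: num_msgs_def)
  have err: "nct_error_prob n 1 QS W (\<lambda>m s. replicate n x0) (\<lambda>y. 0) = 0" for n
    by (subst nct_error_prob_eq) (auto intro!: sum.neutral)
  have "nct_warden_dist n 1 QS W (\<lambda>m s. replicate n x0) = iid_pmf n (innocent_out QS W x0)" for n
  proof -
    have "nct_warden_dist n 1 QS W (\<lambda>m s. replicate n x0)
        = bind_pmf (iid_pmf n QS) (\<lambda>s. seq_pmf (\<lambda>(x, s). map_pmf snd (W x s)) (zip (replicate n x0) s))"
      by (simp add: nct_warden_dist_eq)
    also have "\<dots> = bind_pmf (iid_pmf n QS) (seq_pmf (\<lambda>s. map_pmf snd (W x0 s)))"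
    proof (intro bind_pmf_cong refl)
      fix s assume "s \<in> set_pmf (iid_pmf n QS)"
      hence "zip (replicate n x0) s = map (Pair x0) s"
        by (simp add: set_iid_pmf zip_replicate1)
      thus "seq_pmf (\<lambda>(x, s). map_pmf snd (W x s)) (zip (replicate n x0) s) = seq_pmf (\<lambda>s. map_pmf snd (W x0 s)) s"
        by (simp add: seq_pmf_map)
    qed
    finally show ?thesis by (simp add: bind_iid_seq innocent_out_def)
  qed
  moreover have "KL_div P P = 0" for P :: "'z list pmf"
    by (auto simp: KL_div_def zero_ereal_def set_pmf_eq intro!: sum.neutral)
  ultimately show ?thesis
    unfolding covert_achievable_NCT_def K using err
    by (intro exI[of _ "\<lambda>n m s. replicate n x0"] exI[of _ "\<lambda>n y. 0"]) auto
qed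

section \<open>Mutual information as an expectation\<close>

lemma mutual_inf_eq_expct:
  assumes "finite (set_pmf p)"
  shows "mutual_inf p F G = expct p (\<lambda>w. log 2 (pmf (map_pmf (\<lambda>w. (F w, G w)) p) (F w, G w)
      / (pmf (map_pmf F p) (F w) * pmf (map_pmf G p) (G w))))"
proof -
  let ?pab = "map_pmf (\<lambda>w. (F w, G w)) p"
  have "mutual_inf p F G = expct ?pab (\<lambda>(a, b). log 2 (pmf ?pab (a, b) / (pmf (map_pmf F p) a * pmf (map_pmf G p) b)))"
    using assms by (subst expct_eq_sum[of "set_pmf ?pab"]) (auto simp: mutual_inf_def Let_def case_prod_unfold)
  thus ?thesis by simp
qed

lemma cond_mutual_inf_eq_expct:
  assumes "finite (set_pmf p)"
  shows "cond_mutual_inf p F G H = expct p (\<lambda>w. log 2 (pmf (map_pmf (\<lambda>w. (F w, G w, H w)) p) (F w, G w, H w)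
      * pmf (map_pmf H p) (H w)
      / (pmf (map_pmf (\<lambda>w. (F w, H w)) p) (F w, H w) * pmf (map_pmf (\<lambda>w. (G w, H w)) p) (G w, H w))))"
proof -
  let ?pabc = "map_pmf (\<lambda>w. (F w, G w, H w)) p"
  have "cond_mutual_inf p F G H = expct ?pabc (\<lambda>(a, b, c). log 2 (pmf ?pabc (a, b, c) * pmf (map_pmf H p) c
      / (pmf (map_pmf (\<lambda>w. (F w, H w)) p) (a, c) * pmf (map_pmf (\<lambda>w. (G w, H w)) p) (b, c))))"
    using assms by (subst expct_eq_sum[of "set_pmf ?pabc"]) (auto simp: cond_mutual_inf_def Let_def case_prod_unfold)
  thus ?thesis by simp
qed

text \<open>All three terms are means under the same \<open>p\<close>, so the chain rule reduces to
  a pointwise identity of logarithms.\<close>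

lemma mutual_inf_chain:
  assumes fin: "finite (set_pmf p)"
  shows "mutual_inf p (\<lambda>w. (F w, G w)) H = mutual_inf p F H + cond_mutual_inf p G H F"
  unfolding mutual_inf_eq_expct[OF fin] cond_mutual_inf_eq_expct[OF fin] expct_add[OF fin, symmetric]
proof (rule expct_cong)
  fix w assume w: "w \<in> set_pmf p"
  \<comment> \<open>The two definitions order the components differently; an injective rearrangement
    preserves point masses.\<close>
  have e1: "pmf (map_pmf (\<lambda>w. (G w, H w, F w)) p) (G w, H w, F w) = pmf (map_pmf (\<lambda>w. ((F w, G w), H w)) p) ((F w, G w), H w)"
    using pmf_map_inj'[of "\<lambda>((f, g), h). (g, h, f)" "map_pmf (\<lambda>w. ((F w, G w), H w)) p" "((F w, G w), H w)"]
    by (simp add: pmf.map_comp o_def inj_on_def case_prod_unfold)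
  have e2: "pmf (map_pmf (\<lambda>w. (G w, F w)) p) (G w, F w) = pmf (map_pmf (\<lambda>w. (F w, G w)) p) (F w, G w)"
    using pmf_map_inj'[of "\<lambda>(f, g). (g, f)" "map_pmf (\<lambda>w. (F w, G w)) p" "(F w, G w)"]
    by (simp add: pmf.map_comp o_def inj_on_def case_prod_unfold)
  have e3: "pmf (map_pmf (\<lambda>w. (H w, F w)) p) (H w, F w) = pmf (map_pmf (\<lambda>w. (F w, H w)) p) (F w, H w)"
    using pmf_map_inj'[of "\<lambda>(f, g). (g, f)" "map_pmf (\<lambda>w. (F w, H w)) p" "(F w, H w)"]
    by (simp add: pmf.map_comp o_def inj_on_def case_prod_unfold)
  have p: "pmf (map_pmf (\<lambda>w. ((F w, G w), H w)) p) ((F w, G w), H w) > 0"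
    "pmf (map_pmf (\<lambda>w. (F w, G w)) p) (F w, G w) > 0" "pmf (map_pmf (\<lambda>w. (F w, H w)) p) (F w, H w) > 0"
    "pmf (map_pmf F p) (F w) > 0" "pmf (map_pmf H p) (H w) > 0"
    using w by (auto simp: pmf_positive_iff)
  show "log 2 (pmf (map_pmf (\<lambda>w. ((F w, G w), H w)) p) ((F w, G w), H w) /
          (pmf (map_pmf (\<lambda>w. (F w, G w)) p) (F w, G w) * pmf (map_pmf H p) (H w))) =
    log 2 (pmf (map_pmf (\<lambda>w. (F w, H w)) p) (F w, H w) / (pmf (map_pmf F p) (F w) * pmf (map_pmf H p) (H w))) +
    log 2 (pmf (map_pmf (\<lambda>w. (G w, H w, F w)) p) (G w, H w, F w) * pmf (map_pmf F p) (F w) /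
          (pmf (map_pmf (\<lambda>w. (G w, F w)) p) (G w, F w) * pmf (map_pmf (\<lambda>w. (H w, F w)) p) (H w, F w)))"
    unfolding e1 e2 e3 using p by (simp add: log_divide log_mult)
qed

text \<open>The factor \<open>pmf q (F w)\<close> cancels between the joint mass and the product of
  marginals. This identifies \<open>iS\<close>, \<open>iZ\<close> and \<open>iY\<close> with values
  of \<open>mutual_inf\<close>.\<close>

lemma mutual_inf_kernel:
  assumes fin: "finite (set_pmf p)"
    and joint: "map_pmf (\<lambda>w. (F w, G w)) p = bind_pmf q (\<lambda>a. map_pmf (Pair a) (k a))"
  shows "mutual_inf p F G = expct p (\<lambda>w. log 2 (pmf (k (F w)) (G w) / pmf (bind_pmf q k) (G w)))"
proof -
  have F: "map_pmf F p = q"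
  proof -
    have "map_pmf F p = map_pmf fst (map_pmf (\<lambda>w. (F w, G w)) p)" by (simp add: pmf.map_comp o_def)
    thus ?thesis unfolding joint by (simp add: map_bind_pmf pmf.map_comp o_def bind_return_pmf')
  qed
  have G: "map_pmf G p = bind_pmf q k"
  proof -
    have "map_pmf G p = map_pmf snd (map_pmf (\<lambda>w. (F w, G w)) p)" by (simp add: pmf.map_comp o_def)
    thus ?thesis unfolding joint by (simp add: map_bind_pmf pmf.map_comp o_def)
  qed
  have finq: "finite (set_pmf q)" using fin unfolding F[symmetric] by simp
  have "pmf (bind_pmf q (\<lambda>a. map_pmf (Pair a) (k a))) (a, b) = pmf q a * pmf (k a) b" for a b
  proof -
    have 1: "pmf (map_pmf (Pair a') (k a')) (a, b) = of_bool (a' = a) * pmf (k a') b" for a'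
    proof (cases "a' = a")
      case True
      thus ?thesis by (simp add: pmf_map_inj' inj_on_def)
    next
      case False
      hence "(a, b) \<notin> set_pmf (map_pmf (Pair a') (k a'))" by auto
      thus ?thesis using False unfolding set_pmf_iff by simp
    qed
    have "pmf (bind_pmf q (\<lambda>a. map_pmf (Pair a) (k a))) (a, b)
        = (\<Sum>a'\<in>insert a (set_pmf q). of_bool (a' = a) * (pmf q a' * pmf (k a') b))"
      using finq by (subst pmf_bind_sum[of "insert a (set_pmf q)"]) (auto simp: 1 mult_ac)
    also have "\<dots> = pmf q a * pmf (k a) b"
      using finq by (intro sum_of_bool_eq_mult) auto
    finally show ?thesis .
  qed
  moreover have "pmf q (F w) > 0" if "w \<in> set_pmf p" for w
    using that unfolding F[symmetric] by (auto simp: pmf_positive_iff)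
  ultimately show ?thesis
    unfolding mutual_inf_eq_expct[OF fin] F G joint
    by (intro expct_cong) (auto simp: less_imp_neq[symmetric])
qed

section \<open>Achievability\<close>

text \<open>The upper bound on \<open>R\<close> is the Gelfand-Pinsker rate; the lower one provides
  enough messages to cover the warden's output when \<open>l\<close> is a function of message and
  state.\<close>

lemma covert_achievable_gelfand_pinsker:
  fixes QS :: "'s::finite pmf"
    and W :: "'x::finite \<Rightarrow> 's \<Rightarrow> ('y::finite \<times> 'z::finite) pmf"
    and PU PV :: "nat pmf" and PS :: "nat \<Rightarrow> nat \<Rightarrow> 's pmf" and xf :: "nat \<Rightarrow> 's \<Rightarrow> 'x"
  defines "P \<equiv> nct_joint PU PV PS xf W"
  assumes full: "set_pmf (innocent_out QS W x0) = UNIV"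
    and fin: "finite (set_pmf PU)" "finite (set_pmf PV)"
    and S: "map_pmf jS P = QS" and Z: "map_pmf jZ P = innocent_out QS W x0"
    and R: "0 < R" "mutual_inf P jUV jZ - mutual_inf P jUV jS < R" "R < mutual_inf P jUV jY - mutual_inf P jUV jS"
  shows "covert_achievable_NCT QS W x0 R"
proof -
  define PT where "PT = pair_pmf PU PV"
  define kS where "kS = (\<lambda>(u, v). PS u v)"
  define wY where "wY = (\<lambda>((u::nat, v::nat), s). map_pmf fst (W (xf u s) s))"
  define wZ where "wZ = (\<lambda>((u::nat, v::nat), s). map_pmf snd (W (xf u s) s))"
  interpret A: single_letter PT kS wY wZ
    by standard (use fin in \<open>simp add: PT_def\<close>)
  have finP: "finite (set_pmf P)" using fin by (simp add: P_def nct_joint_def)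
  have JZ: "joint3 PT kS wZ = map_pmf (\<lambda>w. (jUV w, jS w, jZ w)) P"
    by (simp add: joint3_def PT_def kS_def wZ_def P_def nct_joint_def pair_pmf_def bind_assoc_pmf
        bind_return_pmf map_bind_pmf pmf.map_comp o_def case_prod_unfold)
  have JY: "joint3 PT kS wY = map_pmf (\<lambda>w. (jUV w, jS w, jY w)) P"
    by (simp add: joint3_def PT_def kS_def wY_def P_def nct_joint_def pair_pmf_def bind_assoc_pmf
        bind_return_pmf map_bind_pmf pmf.map_comp o_def case_prod_unfold)
  have jS: "map_pmf (\<lambda>w. (jUV w, jS w)) P = bind_pmf PT (\<lambda>t. map_pmf (Pair t) (kS t))"
  proof -
    have "map_pmf (\<lambda>w. (jUV w, jS w)) P = map_pmf (\<lambda>(t, s, z). (t, s)) (joint3 PT kS wZ)"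
      unfolding JZ by (simp add: pmf.map_comp o_def)
    also have "\<dots> = bind_pmf PT (\<lambda>t. map_pmf (Pair t) (kS t))"
      by (simp add: joint3_def map_bind_pmf pmf.map_comp o_def) (simp add: map_pmf_def)
    finally show ?thesis .
  qed
  have jZ: "map_pmf (\<lambda>w. (jUV w, jZ w)) P = bind_pmf PT (\<lambda>t. map_pmf (Pair t) (A.kZ t))"
  proof -
    have "map_pmf (\<lambda>w. (jUV w, jZ w)) P = map_pmf (\<lambda>(t, s, z). (t, z)) (joint3 PT kS wZ)"
      unfolding JZ by (simp add: pmf.map_comp o_def)
    thus ?thesis by (simp add: joint3_def A.kZ_def map_bind_pmf pmf.map_comp o_def)
  qed
  have jY: "map_pmf (\<lambda>w. (jUV w, jY w)) P = bind_pmf PT (\<lambda>t. map_pmf (Pair t) (A.kY t))"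
  proof -
    have "map_pmf (\<lambda>w. (jUV w, jY w)) P = map_pmf (\<lambda>(t, s, y). (t, y)) (joint3 PT kS wY)"
      unfolding JY by (simp add: pmf.map_comp o_def)
    thus ?thesis by (simp add: joint3_def A.kY_def map_bind_pmf pmf.map_comp o_def)
  qed
  have iS: "A.iS = mutual_inf P jUV jS"
    unfolding mutual_inf_kernel[OF finP jS] A.iS_def JZ A.QS_def by simp
  have iZ: "A.iZ = mutual_inf P jUV jZ"
    unfolding mutual_inf_kernel[OF finP jZ] A.iZ_def JZ A.QZ_def by simp
  have iY: "A.iY = mutual_inf P jUV jY"
    unfolding mutual_inf_kernel[OF finP jY] A.iY_def JY A.QY_def by simp
  have QS: "A.QS = QS"
  proof -
    have "QS = map_pmf snd (map_pmf (\<lambda>w. (jUV w, jS w)) P)"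
      unfolding S[symmetric] by (simp add: pmf.map_comp o_def)
    thus ?thesis unfolding jS A.QS_def by (simp add: map_bind_pmf pmf.map_comp o_def)
  qed
  define Q0 where "Q0 = innocent_out QS W x0"
  have QZ: "A.QZ = Q0"
  proof -
    have "Q0 = map_pmf snd (map_pmf (\<lambda>w. (jUV w, jZ w)) P)"
      unfolding Q0_def Z[symmetric] by (simp add: pmf.map_comp o_def)
    thus ?thesis unfolding jZ A.QZ_def by (simp add: map_bind_pmf pmf.map_comp o_def)
  qed

  define good where "good = (\<lambda>b n (f :: nat \<Rightarrow> 's list \<Rightarrow> (nat \<times> nat) list) (dc :: 'y list \<Rightarrow> nat).
    (\<forall>m s. length (f m s) = n) \<and>
    (\<Sum>(m,s)\<in>{..<num_msgs n R} \<times> {s. length s = n}. pmf (iid_pmf n QS) s / real (num_msgs n R)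
        * measure_pmf.prob (seq_pmf wY (zip (f m s) s)) {y. dc y \<noteq> m})
    + (\<Sum>z\<in>{z. length z = n}. \<bar>(\<Sum>(m,s)\<in>{..<num_msgs n R} \<times> {s. length s = n}.
          pmf (iid_pmf n QS) s / real (num_msgs n R) * pmf (seq_pmf wZ (zip (f m s) s)) z) - pmf (iid_pmf n Q0) z\<bar>)
    \<le> b)"
  have "\<exists>C \<rho>. 0 \<le> \<rho> \<and> \<rho> < 1 \<and> (\<forall>n. \<exists>f dc. good (C * \<rho> ^ n) n f dc)"
    using A.block_codes[of R] R unfolding iS iZ iY QS QZ good_def by blast
  then obtain C \<rho> where \<rho>: "0 \<le> \<rho>" "\<rho> < 1" and codes: "\<forall>n. \<exists>f dc. good (C * \<rho> ^ n) n f dc"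
    by blast
  from codes obtain f dc where good: "\<And>n. good (C * \<rho> ^ n) n (f n) (dc n)" by metis
  have len: "length (f n m s) = n" for n m s using good[of n] by (simp add: good_def)
  \<comment> \<open>The input is formed letter by letter from codeword and state, so the kernels
    \<open>wY\<close> and \<open>wZ\<close>, which contain \<open>xf\<close>, describe the
    outputs.\<close>
  define enc where "enc = (\<lambda>n m s. map (\<lambda>((u, v), s). xf u s) (zip (f n m s) s))"
  have zip_enc: "zip (map (\<lambda>((u, v), s). xf u s) (zip ts ss)) ss = map (\<lambda>((u, v), s). (xf u s, s)) (zip ts ss)"
    for ts :: "(nat \<times> nat) list" and ss
  proof (induction ts arbitrary: ss)
    case (Cons t ts)
    thus ?case by (cases ss) (auto simp: case_prod_unfold)
  qed simp
  have seqY: "seq_pmf (\<lambda>(x, s). map_pmf fst (W x s)) (zip (enc n m s) s) = seq_pmf wY (zip (f n m s) s)" for n m s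
    unfolding enc_def zip_enc seq_pmf_map wY_def by (simp add: case_prod_unfold)
  have seqZ: "seq_pmf (\<lambda>(x, s). map_pmf snd (W x s)) (zip (enc n m s) s) = seq_pmf wZ (zip (f n m s) s)" for n m s
    unfolding enc_def zip_enc seq_pmf_map wZ_def by (simp add: case_prod_unfold)
  define er where "er = (\<lambda>n. nct_error_prob n (num_msgs n R) QS W (enc n) (dc n))"
  define wd where "wd = (\<lambda>n. nct_warden_dist n (num_msgs n R) QS W (enc n))"
  define tv where "tv = (\<lambda>n. \<Sum>z\<in>{z. length z = n}. \<bar>pmf (wd n) z - pmf (iid_pmf n Q0) z\<bar>)"
  have sum_le: "er n + tv n \<le> C * \<rho> ^ n" for n
    unfolding er_def tv_def wd_def nct_error_prob_eq[OF num_msgs_pos] pmf_nct_warden_dist[OF num_msgs_pos] seqY seqZ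
    using good[of n] by (simp add: good_def)
  have er0: "er n \<ge> 0" for n by (simp add: er_def nct_error_prob_def)
  have tv0: "tv n \<ge> 0" for n by (simp add: tv_def sum_nonneg)
  have lim: "(\<lambda>n. C * \<rho> ^ n) \<longlonglongrightarrow> 0"
    using tendsto_mult_right_zero[OF LIMSEQ_realpow_zero[OF \<rho>]] by simp
  have er_lim: "er \<longlonglongrightarrow> 0"
    by (rule tendsto_sandwich[OF _ _ tendsto_const lim])
       (use sum_le er0 tv0 in \<open>auto intro!: always_eventually\<close>, smt (verit) sum_le tv0)

  \<comment> \<open>Full support makes the least mass positive; sequences then have mass at least
    \<open>\<mu> ^ n\<close>, and \<open>KL_div_bounds\<close> loses only the factor
    \<open>1 + n * ln (1 / \<mu>)\<close>.\<close>
  define \<mu> where "\<mu> = Min (range (pmf Q0))"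
  have \<mu>_le: "\<mu> \<le> pmf Q0 z" for z by (simp add: \<mu>_def)
  have \<mu>_pos: "\<mu> > 0" using full by (auto simp: \<mu>_def Q0_def[symmetric] pmf_positive_iff)
  have set_Q: "set_pmf (iid_pmf n Q0) = {z. length z = n}" for n
    using full by (simp add: set_iid_pmf Q0_def)
  have "\<exists>x. KL_div (wd n) (iid_pmf n Q0) = ereal x \<and> 0 \<le> x \<and> x \<le> (1 + real n * ln (1 / \<mu>)) * tv n" for n
  proof -
    have "\<exists>x. KL_div (wd n) (iid_pmf n Q0) = ereal x \<and> 0 \<le> x \<and> x \<le> (1 + ln (1 / \<mu> ^ n)) *
      (\<Sum>z\<in>set_pmf (iid_pmf n Q0). \<bar>pmf (wd n) z - pmf (iid_pmf n Q0) z\<bar>)"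
    proof (rule KL_div_bounds)
      show "finite (set_pmf (iid_pmf n Q0))" unfolding set_Q by (rule finite_length_eq)
      show "set_pmf (wd n) \<subseteq> set_pmf (iid_pmf n Q0)"
        unfolding set_Q wd_def nct_warden_dist_eq seqZ
        by (auto simp: set_iid_pmf len dest!: length_seq_pmf)
      show "\<mu> ^ n > 0" using \<mu>_pos by simp
      show "\<mu> ^ n \<le> pmf (iid_pmf n Q0) z" if "z \<in> set_pmf (iid_pmf n Q0)" for z
        using that pmf_iid_ge[of \<mu> Q0 z] \<mu>_le \<mu>_pos unfolding set_Q by auto
    qed
    thus ?thesis using \<mu>_pos by (simp add: set_Q tv_def ln_div ln_realpow)
  qed
  then obtain x where x: "\<And>n. KL_div (wd n) (iid_pmf n Q0) = ereal (x n)" "\<And>n. 0 \<le> x n"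
    "\<And>n. x n \<le> (1 + real n * ln (1 / \<mu>)) * tv n" by metis
  have "\<mu> \<le> 1" using \<mu>_le[of undefined] pmf_le_1[of Q0] order_trans by blast
  hence c: "ln (1 / \<mu>) \<ge> 0" using \<mu>_pos by simp
  have "(\<lambda>n. C * \<rho> ^ n + ln (1 / \<mu>) * C * (real n * \<rho> ^ n)) \<longlonglongrightarrow> 0 + ln (1 / \<mu>) * C * 0"
    using \<rho> by (intro tendsto_intros lim powser_times_n_limit_0) auto
  hence lim2: "(\<lambda>n. C * \<rho> ^ n + ln (1 / \<mu>) * C * (real n * \<rho> ^ n)) \<longlonglongrightarrow> 0" by simp
  have x_le: "x n \<le> C * \<rho> ^ n + ln (1 / \<mu>) * C * (real n * \<rho> ^ n)" for n
  proof -
    have "tv n \<le> C * \<rho> ^ n" using sum_le[of n] er0[of n] by linarith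
    hence "(1 + real n * ln (1 / \<mu>)) * tv n \<le> (1 + real n * ln (1 / \<mu>)) * (C * \<rho> ^ n)"
      using c by (intro mult_left_mono) auto
    also have "\<dots> = C * \<rho> ^ n + ln (1 / \<mu>) * C * (real n * \<rho> ^ n)"
      by (simp add: algebra_simps)
    finally show ?thesis using x(3)[of n] by linarith
  qed
  have "x \<longlonglongrightarrow> 0"
    by (rule tendsto_sandwich[OF _ _ tendsto_const lim2]) (use x x_le in auto)
  hence "(\<lambda>n. ereal (x n)) \<longlonglongrightarrow> ereal 0" by simp
  hence KL_lim: "(\<lambda>n. KL_div (wd n) (iid_pmf n Q0)) \<longlonglongrightarrow> 0"
    by (simp add: x(1) zero_ereal_def)
  have "length (enc n m s) = n" if "length s = n" for n m s
    using that by (simp add: enc_def len)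
  thus ?thesis
    unfolding covert_achievable_NCT_def
    using er_lim KL_lim unfolding er_def[abs_def] wd_def Q0_def
    by (intro exI[of _ enc] exI[of _ dc]) auto
qed

theorem theorem4:
  fixes QS :: "'s::finite pmf"
    and W :: "'x::finite \<Rightarrow> 's \<Rightarrow> ('y::finite \<times> 'z::finite) pmf"
    and x0 :: 'x
  assumes "set_pmf (innocent_out QS W x0) = UNIV"
  shows "Sup (ereal ` rate_set_NCT QS W x0) \<le> covert_capacity_NCT QS W x0"
proof (rule SUP_least)
  fix R assume "R \<in> rate_set_NCT QS W x0"
  then obtain PU PV PS xf where R0: "R \<ge> 0" and D: "in_D_NCT QS W x0 PU PV PS xf"
    and Rle: "R \<le> mutual_inf (nct_joint PU PV PS xf W) jU jY
               - max (mutual_inf (nct_joint PU PV PS xf W) jU jS)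
                     (mutual_inf (nct_joint PU PV PS xf W) jUV jS - cond_mutual_inf (nct_joint PU PV PS xf W) jV jY jU)"
    by (auto simp: rate_set_NCT_def Let_def)
  define P where "P = nct_joint PU PV PS xf W"
  have fin: "finite (set_pmf PU)" "finite (set_pmf PV)"
    using D by (auto simp: in_D_NCT_def Let_def intro: finite_subset)
  have S: "map_pmf jS P = QS" and Z: "map_pmf jZ P = innocent_out QS W x0"
    and gap: "cond_mutual_inf P jV jY jU > mutual_inf P jUV jZ - mutual_inf P jU jY"
    using D by (auto simp: in_D_NCT_def Let_def P_def)
  have finP: "finite (set_pmf P)" using fin by (simp add: P_def nct_joint_def)
  have "jUV = (\<lambda>w::nat \<times> nat \<times> 's \<times> 'x \<times> 'y \<times> 'z. (jU w, jV w))" by auto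
  hence chain: "mutual_inf P jUV jY = mutual_inf P jU jY + cond_mutual_inf P jV jY jU"
    using mutual_inf_chain[OF finP, of jU jV jY] by simp
  define M where "M = mutual_inf P jUV jY - mutual_inf P jUV jS"
  define N where "N = mutual_inf P jUV jZ - mutual_inf P jUV jS"
  \<comment> \<open>By \<open>chain\<close>, the inequality \<open>gap\<close> reads
    \<open>N < M\<close>, and \<open>Rle\<close> yields \<open>R \<le> M\<close>.\<close>
  have NM: "N < M" using gap chain by (simp add: M_def N_def)
  have RM: "R \<le> M" using Rle chain by (simp add: M_def P_def[symmetric])
  have le_cap: "ereal r \<le> covert_capacity_NCT QS W x0" if "covert_achievable_NCT QS W x0 r" for r
    unfolding covert_capacity_NCT_def using that by (intro Sup_upper) auto
  show "ereal R \<le> covert_capacity_NCT QS W x0"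
  proof (cases "R = 0")
    case True
    thus ?thesis using le_cap[OF covert_achievable_zero] by simp
  next
    case False
    show ?thesis
    proof (rule dense_le)
      fix e assume "e < ereal R"
      then obtain r where r: "e < ereal r" "r < R" using ereal_dense2 by force
      \<comment> \<open>\<open>R\<close> may equal \<open>M\<close> or lie below \<open>N\<close>,
        so it is approached from below and, if necessary, the rate is raised to the midpoint of
        \<open>max 0 N\<close> and \<open>M\<close>. Raising is harmless, as a lower bound on a
        supremum is sought.\<close>
      define r' where "r' = max r ((max 0 N + M) / 2)"
      have "0 < r'" "N < r'" "r' < M" using r(2) RM NM R0 False by (auto simp: r'_def max_def)
      hence "covert_achievable_NCT QS W x0 r'"
        using assms fin S Z unfolding P_def M_def N_def by (intro covert_achievable_gelfand_pinsker) auto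
      from le_cap[OF this] have "ereal r' \<le> covert_capacity_NCT QS W x0" .
      moreover have "e \<le> ereal r'" using r(1) by (auto simp: r'_def intro: order_trans[OF less_imp_le])
      ultimately show "e \<le> covert_capacity_NCT QS W x0" by (rule order_trans[rotated])
    qed
  qed
qed

end
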